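(* Let $J$ be the monic Jacobi matrix associated with a nonrational function $F\in\mathbf N_{-\infty}$, and let $J=LU$ be its block $LU$-factorization. Then the matrix $\mathfrak J=UL$ is the monic generalized Jacobi matrix associated with the function $\lambda F(\lambda)+s_0\in\mathbf D^-_{-\infty}$.
   Context: $\lambda\widehat\to\infty$ means that $\lambda\to\infty$ inside a sector $\varepsilon<\arg\lambda<\pi-\varepsilon$, $\varepsilon>0$. $\mathbf N$ is the class of Nevanlinna functions (analytic in $\mathbb C_+$, mapping $\mathbb C_+$ into $\mathbb C_+$). $\mathbf N_{-\infty}$ is the set of $F\in\mathbf N$ for which there are real $s_0,s_1,\dots$ with $F(\lambda)=-\frac{s_0}{\lambda}-\dots-\frac{s_{2n}}{\lambda^{2n+1}}+o(\lambda^{-2n-1})$, $\lambda\widehat\to\infty$, for every $n\in\mathbb Z_+$ (written $F(\lambda)\sim-\sum_j s_j\lambda^{-j-1}$); equivalently $F(\lambda)=\int_{\mathbb R}\frac{d\sigma(t)}{t-\lambda}$ with a finite measure $\sigma$ with moments $s_j=\int t^jd\sigma(t)$. Let $P_j$ be the monic orthogonal polynomials of $\sigma/s_0$: $\lambda P_j=P_{j+1}+b_jP_j+c_{j-1}P_{j-1}$, $P_{-1}=0$, $P_0=1$, $b_j\in\mathbb R$, $c_j>0$. The monic Jacobi matrix $J$ associated with $F$ is the semi-infinite tridiagonal matrix with $J_{j,j}=b_j$, $J_{j,j+1}=1$, $J_{j+1,j}=c_j$. $\mathbf D^-_{-\infty}$: functions $\mathfrak F$ meromorphic in $\mathbb C_+$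 such that for some $\mathfrak s_{-1}\in\mathbb R\setminus\{0\}$ one has $-\frac{\mathfrak s_{-1}}{\lambda}+\frac{\mathfrak F(\lambda)}{\lambda}\in\mathbf N_{-\infty}$. $\mathbf D^+_{-\infty}$: functions $\mathfrak F$ meromorphic in $\mathbb C_+$ with $\mathfrak F(\lambda)\sim-\sum_{j\ge0}\mathfrak s_j\lambda^{-j-1}$, $\mathfrak s_j\in\mathbb R$, and $\lambda\mathfrak F(\lambda)+\mathfrak s_0\in\mathbf N_{-\infty}$. Normal indices of a real sequence $\{\mathfrak s_j\}_{j\ge0}$: the integers $n\ge1$ with $\det(\mathfrak s_{i+k})_{i,k=0}^{n-1}\neq0$, listed increasingly $\mathfrak n_1<\mathfrak n_2<\cdots$; $\mathfrak n_0=0$, $\mathfrak k_j=\mathfrak n_{j+1}-\mathfrak n_j$ (always $\mathfrak k_j\in\{1,2\}$ here). Generalized Jacobi matrix: let $\mathfrak F\in\mathbf D^\pm_{-\infty}$ be nonrational with $\mathfrak F\sim-\sum\mathfrak s_j\lambda^{-j-1}$. It is normalized if its first nonzero coefficient $\mathfrak s_{\mathfrak n_1-1}$ has modulus $1$. For normalized $\mathfrak F$ put $\mathfrak F_0=\mathfrak F$ and define recursively $-1/\mathfrak F_j(\lambda)=\epsilon_j\mathfrak p_j(\lambda)+\mathfrak b_j^2\mathfrak F_{j+1}(\lambda)$, where $\epsilon_j=\pm1$ is the first nonzero asymptotic coefficient of $\mathfrak F_j$, $\mathfrak p_j$ is the monic polynomial (of degree $\mathfrak k_j$) for which $-1/\mathfrak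 F_j-\epsilon_j\mathfrak p_j=o(1)$ as $\lambda\widehat\to\infty$, and $\mathfrak b_j>0$ is such that $\mathfrak F_{j+1}$ is normalized. Put $\mathfrak c_j=\epsilon_j\epsilon_{j+1}\mathfrak b_j^2$; write $\mathfrak p_j(\lambda)=\lambda+\mathfrak p_0^{(j)}$ if $\mathfrak k_j=1$ and $\mathfrak p_j(\lambda)=\lambda^2+\mathfrak p_1^{(j)}\lambda+\mathfrak p_0^{(j)}$ if $\mathfrak k_j=2$. The monic generalized Jacobi matrix associated with $\mathfrak F$ is the block tridiagonal matrix with diagonal blocks $\mathfrak B_j=-\mathfrak p_0^{(j)}$ if $\mathfrak k_j=1$, $\mathfrak B_j=\begin{pmatrix}0&1\\-\mathfrak p_0^{(j)}&-\mathfrak p_1^{(j)}\end{pmatrix}$ if $\mathfrak k_j=2$, superdiagonal blocks $\mathfrak D_j$ ($\mathfrak k_j\times\mathfrak k_{j+1}$, lower-left entry $1$, other entries $0$) and subdiagonal blocks $\mathfrak C_j$ ($\mathfrak k_{j+1}\times\mathfrak k_j$, lower-left entry $\mathfrak c_j$, other entries $0$). If $\mathfrak F$ is not normalized, the matrix associated with $\mathfrak F$ is by definition the one associated with $\mathfrak F/|\mathfrak s_{\mathfrak n_1-1}|$. Block $LU$-factorization of $J$: let $\{\mathfrak n_j\}_{j\ge1}$ be the normal indices of $\{s_{j+1}\}_{j\ge0}$, $\mathfrak n_0=0$, and $\mathfrak k_j=\mathfrak n_{j+1}-\mathfrak n_j$, $j\in\mathbb Z_+$. Then $J=LU$ for unique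 block matrices of the following form: $L$ has identity diagonal blocks $I_{\mathfrak k_j}$, subdiagonal blocks $L_{j+1}$ ($\mathfrak k_{j+1}\times\mathfrak k_j$, upper-left entry $l_{j+1}$, other entries $0$), and zeros elsewhere; $U$ has diagonal blocks $U_j=u_0^{(j)}$ if $\mathfrak k_j=1$, $U_j=\begin{pmatrix}0&1\\ u_0^{(j)}&u_1^{(j)}\end{pmatrix}$ if $\mathfrak k_j=2$, superdiagonal blocks $D_j$ ($\mathfrak k_j\times\mathfrak k_{j+1}$, lower-left entry $1$, other entries $0$), and zeros elsewhere. *)

theory Defs
  imports
    "HOL-Complex_Analysis.Complex_Analysis"
    "HOL-Library.Landau_Symbols"
    "HOL-Library.Groups_Big_Fun"
    "HOL-Library.Infinite_Set"
    "Jordan_Normal_Form.Determinant"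
begin

section \<open>Nevanlinna functions and asymptotic expansions\<close>

definition upper_half_plane :: "complex set" where
  "upper_half_plane = {z. Im z > 0}"

definition sector_at_infinity :: "real \<Rightarrow> complex filter" where
  "sector_at_infinity \<epsilon> = inf at_infinity (principal {z. \<epsilon> < Arg z \<and> Arg z < pi - \<epsilon>})"

text \<open>
  The expansion \<open>F(z) ~ - s\<^sub>0/z - s\<^sub>1/z^2 - ...\<close> is required in every sector, that is, for every
  \<open>\<epsilon> > 0\<close>. For \<open>\<epsilon> \<ge> pi/2\<close> the sector is empty and the condition is void.
\<close>

definition asymptotic_expansion :: "(complex \<Rightarrow> complex) \<Rightarrow> (nat \<Rightarrow> real) \<Rightarrow> bool" where
  "asymptotic_expansion F s \<longleftrightarrow>
     (\<forall>\<epsilon>>0. \<forall>n. (\<lambda>z. F z + (\<Sum>j\<le>2 * n. of_real (s j) / z ^ (j + 1)))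
                \<in> o[sector_at_infinity \<epsilon>](\<lambda>z. 1 / z ^ (2 * n + 1)))"

definition Nevanlinna :: "(complex \<Rightarrow> complex) set" where
  "Nevanlinna = {F. F holomorphic_on upper_half_plane \<and> F ` upper_half_plane \<subseteq> upper_half_plane}"

definition Nevanlinna_minf :: "(complex \<Rightarrow> complex) set" where
  "Nevanlinna_minf = {F \<in> Nevanlinna. \<exists>s. asymptotic_expansion F s}"

definition D_minus :: "(complex \<Rightarrow> complex) set" where
  "D_minus = {F. F meromorphic_on upper_half_plane \<and>
     (\<exists>s::real. s \<noteq> 0 \<and> (\<lambda>z. - (of_real s / z) + F z / z) \<in> Nevanlinna_minf)}"

definition D_plus :: "(complex \<Rightarrow> complex) set" where
  "D_plus = {F. F meromorphic_on upper_half_plane \<and>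
     (\<exists>s. asymptotic_expansion F s \<and> (\<lambda>z. z * F z + of_real (s 0)) \<in> Nevanlinna_minf)}"

text \<open>
  Values of meromorphic functions at individual points (such as poles) carry no information, so
  identities between them are stated off a set that is sparse in the half-plane.
\<close>

definition rational_function :: "(complex \<Rightarrow> complex) \<Rightarrow> bool" where
  "rational_function F \<longleftrightarrow>
     (\<exists>p q. q \<noteq> 0 \<and> (\<forall>\<^sub>\<approx>z\<in>upper_half_plane. F z = poly p z / poly q z))"

section \<open>Semi-infinite matrices\<close>

type_synonym inf_matrix = "nat \<Rightarrow> nat \<Rightarrow> real"

text \<open>Every product formed below has only finitely many nonzero terms in each entry.\<close>

definition inf_matrix_mult :: "inf_matrix \<Rightarrow> inf_matrix \<Rightarrow> inf_matrix" where
  "inf_matrix_mult A B = (\<lambda>i j. Sum_any (\<lambda>k. A i k * B k j))"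

text \<open>
  A block matrix is an ordinary matrix on \<open>nat \<times> nat\<close>. The partition is given by the strictly
  increasing sequence \<open>n 0 = 0, n 1, ...\<close> of the first indices of the blocks, so block \<open>j\<close> occupies
  the indices \<open>n j, ..., n (j + 1) - 1\<close>.
\<close>

definition block_of :: "(nat \<Rightarrow> nat) \<Rightarrow> nat \<Rightarrow> nat" where
  "block_of n i = (THE j. n j \<le> i \<and> i < n (Suc j))"

text \<open>
  \<open>lo j\<close> is the block in position \<open>(j + 1, j)\<close> and \<open>up j\<close> the block in position \<open>(j, j + 1)\<close>. Entries
  inside a block are indexed from \<open>0\<close>.
\<close>

definition block_tridiagonal ::
  "(nat \<Rightarrow> nat) \<Rightarrow> (nat \<Rightarrow> inf_matrix) \<Rightarrow> (nat \<Rightarrow> inf_matrix) \<Rightarrow> (nat \<Rightarrow> inf_matrix) \<Rightarrow> inf_matrix" where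
  "block_tridiagonal n lo di up = (\<lambda>r c.
     let i = block_of n r; j = block_of n c; a = r - n i; b = c - n j in
       if i = j then di i a b
       else if j = Suc i then up i a b
       else if i = Suc j then lo j a b
       else 0)"

definition identity_block :: inf_matrix where
  "identity_block = (\<lambda>a b. if a = b then 1 else 0)"

definition upper_left_block :: "real \<Rightarrow> inf_matrix" where
  "upper_left_block x = (\<lambda>a b. if a = 0 \<and> b = 0 then x else 0)"

text \<open>The argument \<open>k\<close> is the number of rows of the block.\<close>

definition lower_left_block :: "nat \<Rightarrow> real \<Rightarrow> inf_matrix" where
  "lower_left_block k x = (\<lambda>a b. if a = k - 1 \<and> b = 0 then x else 0)"

text \<open>The \<open>1 \<times> 1\<close> block \<open>x\<close> if \<open>k = 1\<close>; the \<open>2 \<times> 2\<close> block with rows \<open>(0, 1)\<close> and \<open>(x, y)\<close> if \<open>k = 2\<close>.\<close>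

definition diagonal_block :: "nat \<Rightarrow> real \<Rightarrow> real \<Rightarrow> inf_matrix" where
  "diagonal_block k x y = (\<lambda>a b.
     if k = 1 then x
     else if a = 0 then (if b = 0 then 0 else 1)
     else (if b = 0 then x else y))"

section \<open>Normal indices\<close>

definition normal_indices :: "(nat \<Rightarrow> real) \<Rightarrow> nat set" where
  "normal_indices s = {n. n \<ge> 1 \<and> Determinant.det (Matrix.mat n n (\<lambda>(i, k). s (i + k))) \<noteq> 0}"

primrec normal_index :: "(nat \<Rightarrow> real) \<Rightarrow> nat \<Rightarrow> nat" where
  "normal_index s 0 = 0"
| "normal_index s (Suc j) = enumerate (normal_indices s) j"

definition normal_gap :: "(nat \<Rightarrow> real) \<Rightarrow> nat \<Rightarrow> nat" where
  "normal_gap s j = normal_index s (Suc j) - normal_index s j"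

section \<open>The monic Jacobi matrix of a Nevanlinna function\<close>

definition monic_Jacobi_matrix :: "(nat \<Rightarrow> real) \<Rightarrow> (nat \<Rightarrow> real) \<Rightarrow> inf_matrix" where
  "monic_Jacobi_matrix b c = (\<lambda>i j.
     if i = j then b i else if j = Suc i then 1 else if i = Suc j then c j else 0)"

text \<open>
  Orthogonality and monicity do not change when \<open>\<sigma>\<close> is divided by \<open>s\<^sub>0\<close>, so the normalization
  \<open>\<sigma> / s\<^sub>0\<close> is not written out.
\<close>

definition monic_Jacobi_matrix_of :: "(complex \<Rightarrow> complex) \<Rightarrow> inf_matrix \<Rightarrow> bool" where
  "monic_Jacobi_matrix_of F J \<longleftrightarrow>
     (\<exists>(\<sigma>::real measure) (P::nat \<Rightarrow> real poly) b c.
        finite_measure \<sigma> \<and> sets \<sigma> = sets borel \<and>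
        (\<forall>j. integrable \<sigma> (\<lambda>t. t ^ j)) \<and>
        (\<forall>z\<in>upper_half_plane. F z = (LINT t|\<sigma>. 1 / (complex_of_real t - z))) \<and>
        (\<forall>j. degree (P j) = j \<and> lead_coeff (P j) = 1) \<and>
        (\<forall>i j. i \<noteq> j \<longrightarrow> (LINT t|\<sigma>. poly (P i) t * poly (P j) t) = 0) \<and>
        (\<forall>j. [:0, 1:] * P j = P (Suc j) + Polynomial.smult (b j) (P j)
                + (if j = 0 then 0 else Polynomial.smult (c (j - 1)) (P (j - 1)))) \<and>
        (\<forall>j. c j > 0) \<and>
        J = monic_Jacobi_matrix b c)"

section \<open>Block LU-factorization\<close>

text \<open>Here \<open>s\<close> is the moment sequence of the function that \<open>J\<close> is associated with.\<close>

definition block_LU_factorization ::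
  "(nat \<Rightarrow> real) \<Rightarrow> inf_matrix \<Rightarrow> inf_matrix \<Rightarrow> inf_matrix \<Rightarrow> bool" where
  "block_LU_factorization s J L U \<longleftrightarrow>
     (let n = normal_index (\<lambda>j. s (j + 1)); k = normal_gap (\<lambda>j. s (j + 1)) in
      \<exists>l u\<^sub>0 u\<^sub>1.
        L = block_tridiagonal n
              (\<lambda>j. upper_left_block (l (Suc j)))
              (\<lambda>j. identity_block)
              (\<lambda>j a b. 0) \<and>
        U = block_tridiagonal n
              (\<lambda>j a b. 0)
              (\<lambda>j. diagonal_block (k j) (u\<^sub>0 j) (u\<^sub>1 j))
              (\<lambda>j. lower_left_block (k j) 1) \<and>
        J = inf_matrix_mult L U)"

section \<open>Generalized Jacobi matrices\<close>

definition first_coefficient :: "(nat \<Rightarrow> real) \<Rightarrow> real" where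
  "first_coefficient s = s (LEAST j. s j \<noteq> 0)"

text \<open>
  \<open>G\<close> is the sequence of functions produced by the recursion and \<open>t j\<close> the coefficient sequence of
  \<open>G j\<close>. For normalized \<open>F\<close> the divisor in the definition of \<open>G 0\<close> is \<open>1\<close>, so both the normalized
  and the general case are covered.
\<close>

definition generalized_Jacobi_matrix_of :: "(complex \<Rightarrow> complex) \<Rightarrow> inf_matrix \<Rightarrow> bool" where
  "generalized_Jacobi_matrix_of F M \<longleftrightarrow>
     F \<in> D_minus \<union> D_plus \<and> \<not> rational_function F \<and>
     (\<exists>s (G::nat \<Rightarrow> complex \<Rightarrow> complex) (t::nat \<Rightarrow> nat \<Rightarrow> real) (e::nat \<Rightarrow> real)
        (p::nat \<Rightarrow> real poly) (b::nat \<Rightarrow> real).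
        let n = normal_index s; k = normal_gap s; c = (\<lambda>j. e j * e (Suc j) * (b j)\<^sup>2) in
        asymptotic_expansion F s \<and>
        G 0 = (\<lambda>z. F z / of_real \<bar>first_coefficient s\<bar>) \<and>
        (\<forall>j. G j meromorphic_on upper_half_plane \<and>
             asymptotic_expansion (G j) (t j) \<and>
             e j = first_coefficient (t j) \<and> (e j = 1 \<or> e j = -1) \<and>
             degree (p j) = k j \<and> lead_coeff (p j) = 1 \<and>
             (\<forall>\<epsilon>>0. (\<lambda>z. - 1 / G j z - of_real (e j) * poly (map_poly of_real (p j)) z)
                       \<in> o[sector_at_infinity \<epsilon>](\<lambda>_. 1)) \<and>
             b j > 0 \<and>
             (\<forall>\<^sub>\<approx>z\<in>upper_half_plane.
                - 1 / G j z = of_real (e j) * poly (map_poly of_real (p j)) z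
                              + of_real ((b j)\<^sup>2) * G (Suc j) z)) \<and>
        M = block_tridiagonal n
              (\<lambda>j. lower_left_block (k (Suc j)) (c j))
              (\<lambda>j. diagonal_block (k j) (- coeff (p j) 0) (- coeff (p j) 1))
              (\<lambda>j. lower_left_block (k j) 1))"

end

theory Submission
  imports Defs
begin

text \<open>
  The functions of the second kind \<open>Q\<^sub>m z = \<integral> P\<^sub>m t / (t - z) d\<sigma> t\<close>, with \<open>Q\<^sub>0 = F\<close>, form a column
  vector \<open>Q\<close> with \<open>J Q = z Q + s\<^sub>0 e\<^sub>0\<close>. Put \<open>R = U Q\<close>. From \<open>L R = z Q + s\<^sub>0 e\<^sub>0\<close> and because the first row
  of \<open>L\<close> is that of the identity, the first component of \<open>R\<close> is \<open>z F z + s\<^sub>0\<close>, and multiplication by \<open>U\<close>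
  gives \<open>(U L) R = z R + s\<^sub>0 U e\<^sub>0\<close>. So \<open>R\<close> solves the recurrence of the block tridiagonal matrix \<open>U L\<close>.
  Eliminating the second component in each block of size \<open>2\<close> leaves a three-term recurrence for the
  first components \<open>r\<^sub>j\<close> of the blocks (lemma \<open>r_Suc\<close>), with the coefficients of \<open>U L\<close>. Its quotients
  \<open>r\<^sub>j / r\<^sub>j\<^sub>-\<^sub>1\<close>, suitably scaled, satisfy the recursion that defines the generalized Jacobi matrix
  (lemma \<open>G_recursion\<close>). At \<open>j = 0\<close> the constant \<open>- s\<^sub>0\<close> takes the place of the missing predecessor, so the
  recursion starts with a multiple of \<open>r\<^sub>0 = z F z + s\<^sub>0\<close> itself.

  The degrees and normalizations in that recursion are asymptotic statements. By orthogonality \<open>Q\<^sub>m\<close>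
  starts with \<open>- h\<^sub>m / z^(m+1)\<close>, where \<open>h\<^sub>m\<close> is the squared norm of \<open>P\<^sub>m\<close>. Hence \<open>r\<^sub>j\<close> has a full expansion
  whose leading term is a nonzero multiple of \<open>1 / z^n\<close>, with \<open>n\<close> the index following block \<open>j\<close> (lemma
  \<open>r_expands\<close>), and the quotients have expansions starting at \<open>1 / z^k\<close>, with \<open>k\<close> the size of block
  \<open>j\<close> (lemma \<open>G_expands\<close>). The signs are those of the entries \<open>u\<^sub>0\<close>.

  Finally, the blocks have size \<open>1\<close> or \<open>2\<close>: if the \<open>n\<close>-th Hankel determinant of the shifted moments
  vanishes, then so does \<open>P\<^sub>n 0\<close>, and two consecutive orthogonal polynomials have no common zero
  (lemma \<open>moment_normal_indices\<close>).
\<close>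

section \<open>Expansions in powers of \<open>1 / z\<close> in sectors\<close>

text \<open>
  Expansions in powers of \<open>1 / z\<close> are recorded by a formal power series whose variable stands for
  \<open>1 / z\<close>. A constant term is allowed, and the error after the terms of index below \<open>N\<close> is required
  to be \<open>O(z^(-N))\<close> in every sector.
\<close>

definition expands :: "(complex \<Rightarrow> complex) \<Rightarrow> real fps \<Rightarrow> bool" where
  "expands f a \<longleftrightarrow> (\<forall>\<epsilon>>0. \<forall>N.
     (\<lambda>z. f z - (\<Sum>j<N. of_real (fps_nth a j) / z ^ j)) \<in> O[sector_at_infinity \<epsilon>](\<lambda>z. 1 / z ^ N))"

lemma eventually_sectorI:
  assumes "\<And>z. R \<le> norm z \<Longrightarrow> \<epsilon> < Arg z \<Longrightarrow> Arg z < pi - \<epsilon> \<Longrightarrow> P z"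
  shows "eventually P (sector_at_infinity \<epsilon>)"
  unfolding sector_at_infinity_def eventually_inf_principal eventually_at_infinity
  using assms by blast

lemma Im_lower_bound_in_sector:
  assumes "0 < \<epsilon>" "\<epsilon> < Arg z" "Arg z < pi - \<epsilon>"
  shows "norm z * sin \<epsilon> \<le> Im z"
proof -
  have "sin \<epsilon> \<le> sin (Arg z)"
  proof (cases "Arg z \<le> pi / 2")
    case True
    then show ?thesis using assms by (intro sin_monotone_2pi_le) auto
  next
    case False
    have "sin \<epsilon> \<le> sin (pi - Arg z)"
      using assms False by (intro sin_monotone_2pi_le) auto
    then show ?thesis by simp
  qed
  moreover have "Im z = norm z * sin (Arg z)"
    by (metis Im_rcis rcis_cmod_Arg)
  ultimately show ?thesis by (simp add: mult_left_mono)
qed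

lemma sin_pos_in_sector:
  fixes \<theta> :: real
  assumes "0 < \<epsilon>" "\<epsilon> < \<theta>" "\<theta> < pi - \<epsilon>"
  shows "0 < sin \<epsilon>"
  using assms by (intro sin_gt_zero) auto

lemma eventually_sector_upper_half_plane:
  assumes "0 < \<epsilon>"
  shows "\<forall>\<^sub>F z in sector_at_infinity \<epsilon>. z \<in> upper_half_plane"
proof (rule eventually_sectorI[where R = 1])
  fix z assume z: "1 \<le> norm z" "\<epsilon> < Arg z" "Arg z < pi - \<epsilon>"
  have "0 < norm z * sin \<epsilon>"
    using sin_pos_in_sector[OF assms z(2,3)] z(1) by (intro mult_pos_pos) auto
  then show "z \<in> upper_half_plane"
    using Im_lower_bound_in_sector[OF assms z(2,3)] by (simp add: upper_half_plane_def)
qed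

lemma eventually_sector_nonzero: "\<forall>\<^sub>F z in sector_at_infinity \<epsilon>. z \<noteq> 0"
  by (rule eventually_sectorI[where R = 1]) auto

lemma filterlim_sector_inverse: "((\<lambda>z. 1 / z) \<longlongrightarrow> 0) (sector_at_infinity \<epsilon>)"
  unfolding sector_at_infinity_def
  by (rule tendsto_mono[OF inf_le1, OF tendsto_inverse_0, unfolded inverse_eq_divide])

lemma sector_power_smallo: "m < n \<Longrightarrow> (\<lambda>z. 1 / z ^ n) \<in> o[sector_at_infinity \<epsilon>](\<lambda>z. 1 / z ^ m)"
proof -
  assume "m < n"
  then have "((\<lambda>z::complex. (1 / z) ^ (n - m)) \<longlongrightarrow> 0) (sector_at_infinity \<epsilon>)"
    using tendsto_power[OF filterlim_sector_inverse, where n = "n - m"] by (simp add: zero_power)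
  moreover have "\<forall>\<^sub>F z in sector_at_infinity \<epsilon>. (1 / z) ^ (n - m) = (1 / z ^ n) / (1 / z ^ m)"
    using eventually_sector_nonzero[of \<epsilon>]
    by eventually_elim (use \<open>m < n\<close> in \<open>simp add: power_divide power_diff field_simps\<close>)
  ultimately have "((\<lambda>z::complex. (1 / z ^ n) / (1 / z ^ m)) \<longlongrightarrow> 0) (sector_at_infinity \<epsilon>)"
    by (rule Lim_transform_eventually)
  moreover have "\<forall>\<^sub>F z::complex in sector_at_infinity \<epsilon>. 1 / z ^ m \<noteq> 0"
    using eventually_sector_nonzero by eventually_elim simp
  ultimately show ?thesis by (rule smalloI_tendsto)
qed

lemma sector_power_bigo: "m \<le> n \<Longrightarrow> (\<lambda>z. 1 / z ^ n) \<in> O[sector_at_infinity \<epsilon>](\<lambda>z. 1 / z ^ m)"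
  using sector_power_smallo[of m n \<epsilon>] by (cases "m = n") (auto intro: landau_o.small_imp_big)

lemma sector_at_infinity_neq_bot: "sector_at_infinity 1 \<noteq> bot"
proof -
  have A: "Arg (of_real x * \<i>) = pi / 2" if "0 < x" for x :: real
    using that by (simp add: Arg_times_of_real)
  have "filterlim (\<lambda>x. of_real x * \<i>) (sector_at_infinity 1) at_top"
    unfolding sector_at_infinity_def filterlim_inf filterlim_principal
  proof
    show "filterlim (\<lambda>x. of_real x * \<i>) at_infinity at_top"
    proof (rule filterlim_norm_at_top_imp_at_infinity)
      show "filterlim (\<lambda>x. norm (complex_of_real x * \<i>)) at_top at_top"
        by (rule filterlim_at_top_mono[OF filterlim_ident]) (simp add: norm_mult abs_ge_self)
    qed
    show "\<forall>\<^sub>F x in at_top. complex_of_real x * \<i> \<in> {z. 1 < Arg z \<and> Arg z < pi - 1}"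
      using eventually_gt_at_top[of 0]
      by eventually_elim (use pi_gt3 in \<open>simp add: A\<close>)
  qed
  then have "sector_at_infinity 1 = bot \<Longrightarrow> (at_top :: real filter) = bot"
    by (simp add: filterlim_def bot.extremum_unique filtermap_bot_iff)
  then show ?thesis by auto
qed

text \<open>
  Uniqueness only needs one sector in which infinity can be approached; \<open>\<epsilon> = 1\<close> serves because
  \<open>1 < pi / 2\<close>.
\<close>

lemma expands_unique:
  assumes "expands f a" "expands f b"
  shows "a = b"
proof (rule fps_ext)
  fix i
  show "fps_nth a i = fps_nth b i"
  proof (induction i rule: less_induct)
    case (less i)
    let ?c = "complex_of_real (fps_nth a i - fps_nth b i)"
    have "(\<lambda>z. (f z - (\<Sum>j<Suc i. of_real (fps_nth b j) / z ^ j))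
             - (f z - (\<Sum>j<Suc i. of_real (fps_nth a j) / z ^ j)))
          \<in> O[sector_at_infinity 1](\<lambda>z. 1 / z ^ Suc i)"
      by (rule sum_in_bigo(2)) (use assms in \<open>simp_all only: expands_def zero_less_one\<close>)
    moreover have "(\<Sum>j<i. complex_of_real (fps_nth a j) / z ^ j)
                 = (\<Sum>j<i. of_real (fps_nth b j) / z ^ j)" for z :: complex
      using less by (intro sum.cong) auto
    ultimately have "(\<lambda>z. ?c * (1 / z ^ i)) \<in> O[sector_at_infinity 1](\<lambda>z. 1 / z ^ Suc i)"
      by (simp add: diff_divide_distrib algebra_simps)
    also have "(\<lambda>z. 1 / z ^ Suc i) \<in> o[sector_at_infinity 1](\<lambda>z. 1 / z ^ i)"
      by (rule sector_power_smallo) auto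
    finally have *: "(\<lambda>z. ?c * (1 / z ^ i)) \<in> o[sector_at_infinity 1](\<lambda>z. 1 / z ^ i)" .
    show ?case
    proof (rule ccontr)
      assume "fps_nth a i \<noteq> fps_nth b i"
      then have "?c \<noteq> 0" by simp
      from * have "(\<lambda>z. 1 / z ^ i) \<in> o[sector_at_infinity 1](\<lambda>z. 1 / z ^ i)"
        unfolding landau_o.small.cmult_in_iff[OF \<open>?c \<noteq> 0\<close>] .
      then have "\<forall>\<^sub>F z::complex in sector_at_infinity 1. 1 / z ^ i = 0"
        by (simp add: landau_o.small_refl_iff)
      then have "\<forall>\<^sub>F z::complex in sector_at_infinity 1. False"
        using eventually_sector_nonzero[of 1] by eventually_elim auto
      with sector_at_infinity_neq_bot show False by (simp add: eventually_False)
    qed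
  qed
qed

lemma expands_cong:
  assumes "expands f a" "\<And>\<epsilon>. 0 < \<epsilon> \<Longrightarrow> \<forall>\<^sub>F z in sector_at_infinity \<epsilon>. f z = g z"
  shows "expands g a"
  unfolding expands_def
proof (intro allI impI)
  fix \<epsilon> :: real and N assume "0 < \<epsilon>"
  have "(\<lambda>z. f z - (\<Sum>j<N. of_real (fps_nth a j) / z ^ j)) \<in> O[sector_at_infinity \<epsilon>](\<lambda>z. 1 / z ^ N)"
    using assms(1) \<open>0 < \<epsilon>\<close> by (simp add: expands_def)
  also have "?this \<longleftrightarrow> (\<lambda>z. g z - (\<Sum>j<N. of_real (fps_nth a j) / z ^ j)) \<in> O[sector_at_infinity \<epsilon>](\<lambda>z. 1 / z ^ N)"
    by (rule landau_o.big.in_cong) (use assms(2)[OF \<open>0 < \<epsilon>\<close>] in eventually_elim, simp)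
  finally show "(\<lambda>z. g z - (\<Sum>j<N. of_real (fps_nth a j) / z ^ j)) \<in> O[sector_at_infinity \<epsilon>](\<lambda>z. 1 / z ^ N)" .
qed

lemma expands_add:
  assumes "expands f a" "expands g b"
  shows "expands (\<lambda>z. f z + g z) (a + b)"
  unfolding expands_def
proof (intro allI impI)
  fix \<epsilon> :: real and N assume "0 < \<epsilon>"
  then have "(\<lambda>z. (f z - (\<Sum>j<N. of_real (fps_nth a j) / z ^ j))
      + (g z - (\<Sum>j<N. of_real (fps_nth b j) / z ^ j))) \<in> O[sector_at_infinity \<epsilon>](\<lambda>z. 1 / z ^ N)"
    using assms by (intro sum_in_bigo(1)) (simp_all add: expands_def)
  then show "(\<lambda>z. f z + g z - (\<Sum>j<N. of_real (fps_nth (a + b) j) / z ^ j))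
      \<in> O[sector_at_infinity \<epsilon>](\<lambda>z. 1 / z ^ N)"
    by (simp add: add_divide_distrib sum.distrib algebra_simps)
qed

lemma expands_cmult:
  assumes "expands f a"
  shows "expands (\<lambda>z. of_real c * f z) (fps_const c * a)"
  unfolding expands_def
proof (intro allI impI)
  fix \<epsilon> :: real and N assume "0 < \<epsilon>"
  then have "(\<lambda>z. of_real c * (f z - (\<Sum>j<N. of_real (fps_nth a j) / z ^ j)))
      \<in> O[sector_at_infinity \<epsilon>](\<lambda>z. 1 / z ^ N)"
    using assms by (cases "c = 0") (simp_all add: expands_def)
  then show "(\<lambda>z. of_real c * f z - (\<Sum>j<N. of_real (fps_nth (fps_const c * a) j) / z ^ j))
      \<in> O[sector_at_infinity \<epsilon>](\<lambda>z. 1 / z ^ N)"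
    by (simp add: sum_distrib_left algebra_simps)
qed

lemma expands_const: "expands (\<lambda>z. of_real c) (fps_const c)"
  unfolding expands_def
proof (intro allI impI)
  fix \<epsilon> :: real and N assume "0 < \<epsilon>"
  have "(\<Sum>j<N. complex_of_real (fps_nth (fps_const c) j) / z ^ j) = (if N = 0 then 0 else of_real c)"
    for z :: complex
    by (induction N) auto
  then show "(\<lambda>z. of_real c - (\<Sum>j<N. of_real (fps_nth (fps_const c) j) / z ^ j))
      \<in> O[sector_at_infinity \<epsilon>](\<lambda>z. 1 / z ^ N)"
    by (cases "N = 0") simp_all
qed

lemma expands_times:
  assumes "expands f a" "fps_nth a 0 = 0"
  shows "expands (\<lambda>z. z * f z) (fps_shift 1 a)"
  unfolding expands_def
proof (intro allI impI)
  fix \<epsilon> :: real and N assume "0 < \<epsilon>"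
  then have "(\<lambda>z. f z - (\<Sum>j<Suc N. of_real (fps_nth a j) / z ^ j))
      \<in> O[sector_at_infinity \<epsilon>](\<lambda>z. 1 / z ^ Suc N)"
    using assms(1) unfolding expands_def by blast
  then have "(\<lambda>z. z * (f z - (\<Sum>j<Suc N. of_real (fps_nth a j) / z ^ j)))
      \<in> O[sector_at_infinity \<epsilon>](\<lambda>z. z * (1 / z ^ Suc N))"
    by (intro landau_o.big.mult landau_o.big_refl)
  also have "?this \<longleftrightarrow> (\<lambda>z. z * f z - (\<Sum>j<N. of_real (fps_nth (fps_shift 1 a) j) / z ^ j))
      \<in> O[sector_at_infinity \<epsilon>](\<lambda>z. 1 / z ^ N)"
  proof (rule landau_o.big.cong_ex)
    show "\<forall>\<^sub>F z in sector_at_infinity \<epsilon>. z * (f z - (\<Sum>j<Suc N. of_real (fps_nth a j) / z ^ j))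
        = z * f z - (\<Sum>j<N. of_real (fps_nth (fps_shift 1 a) j) / z ^ j)"
      using eventually_sector_nonzero
    proof eventually_elim
      case (elim z)
      then show ?case
        unfolding sum.lessThan_Suc_shift using assms(2)
        by (simp add: right_diff_distrib sum_distrib_left)
    qed
    show "\<forall>\<^sub>F z::complex in sector_at_infinity \<epsilon>. z * (1 / z ^ Suc N) = 1 / z ^ N"
      using eventually_sector_nonzero by eventually_elim simp
  qed
  finally show "(\<lambda>z. z * f z - (\<Sum>j<N. of_real (fps_nth (fps_shift 1 a) j) / z ^ j))
      \<in> O[sector_at_infinity \<epsilon>](\<lambda>z. 1 / z ^ N)" .
qed

lemma expands_times_power:
  assumes "expands f a" "\<forall>i<n. fps_nth a i = 0"
  shows "expands (\<lambda>z. z ^ n * f z) (fps_shift n a)"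
  using assms(2)
proof (induction n)
  case (Suc n)
  then have "expands (\<lambda>z. z * (z ^ n * f z)) (fps_shift 1 (fps_shift n a))"
    by (intro expands_times) auto
  then show ?case
    by (simp add: mult.assoc fps_shift_fps_shift[symmetric])
qed (use assms(1) in auto)

lemma expands_over_var:
  assumes "expands f a"
  shows "expands (\<lambda>z. f z / z) (fps_X * a)"
  unfolding expands_def
proof (intro allI impI)
  fix \<epsilon> :: real and N assume "0 < \<epsilon>"
  have *: "(\<lambda>z. (1 / z) * (f z - (\<Sum>j<M. of_real (fps_nth a j) / z ^ j)))
      \<in> O[sector_at_infinity \<epsilon>](\<lambda>z. (1 / z) * (1 / z ^ M))" for M
    using assms \<open>0 < \<epsilon>\<close> by (intro landau_o.big.mult landau_o.big_refl) (simp add: expands_def)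
  show "(\<lambda>z. f z / z - (\<Sum>j<N. of_real (fps_nth (fps_X * a) j) / z ^ j))
      \<in> O[sector_at_infinity \<epsilon>](\<lambda>z. 1 / z ^ N)"
  proof (cases N)
    case 0
    have "(\<lambda>z. (1 / z) * (1 / z ^ 0)) \<in> O[sector_at_infinity \<epsilon>](\<lambda>z. 1 / z ^ 0)"
      using sector_power_bigo[of 0 1 \<epsilon>] by simp
    from landau_o.big_trans[OF *[of 0] this] show ?thesis by (simp add: 0)
  next
    case (Suc M)
    show ?thesis
      using *[of M] unfolding Suc sum.lessThan_Suc_shift
      by (simp add: right_diff_distrib sum_distrib_left sum_divide_distrib diff_divide_distrib mult_ac)
  qed
qed

lemma expands_over_power:
  assumes "expands f a"
  shows "expands (\<lambda>z. f z / z ^ n) (fps_X ^ n * a)"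
proof (induction n)
  case (Suc n)
  from expands_over_var[OF this] show ?case by (simp add: mult_ac)
qed (use assms in simp)

lemma expands_tendsto:
  assumes "expands f a" "0 < \<epsilon>"
  shows "(f \<longlongrightarrow> of_real (fps_nth a 0)) (sector_at_infinity \<epsilon>)"
proof -
  have "(\<lambda>z. f z - (\<Sum>j<1. of_real (fps_nth a j) / z ^ j)) \<in> O[sector_at_infinity \<epsilon>](\<lambda>z. 1 / z ^ 1)"
    using assms unfolding expands_def by blast
  also have "(\<lambda>z. 1 / z ^ 1) \<in> o[sector_at_infinity \<epsilon>](\<lambda>z. 1 / z ^ 0)"
    by (rule sector_power_smallo) simp
  finally have "((\<lambda>z. f z - of_real (fps_nth a 0)) \<longlongrightarrow> 0) (sector_at_infinity \<epsilon>)"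
    by (auto dest: smalloD_tendsto)
  then show ?thesis by (subst Lim_null)
qed

text \<open>
  Induction on the number of terms: with \<open>q\<close> the quotient of the constant terms,
  \<open>f / g = q + (1 / z) * (z * (f - q * g) / g)\<close>, where \<open>z * (f - q * g)\<close> again has an expansion.
\<close>

lemma expands_divide:
  assumes "expands f a" "expands g b" "fps_nth b 0 \<noteq> 0"
  shows "expands (\<lambda>z. f z / g z) (a / b)"
  unfolding expands_def
proof (intro allI impI)
  fix \<epsilon> :: real and N assume "0 < \<epsilon>"
  note lim_g = expands_tendsto[OF assms(2) \<open>0 < \<epsilon>\<close>]
  have g_nz: "\<forall>\<^sub>F z in sector_at_infinity \<epsilon>. g z \<noteq> 0"
    using tendsto_imp_eventually_ne[OF lim_g, of 0] assms(3) by simp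
  show "(\<lambda>z. f z / g z - (\<Sum>j<N. of_real (fps_nth (a / b) j) / z ^ j))
      \<in> O[sector_at_infinity \<epsilon>](\<lambda>z. 1 / z ^ N)"
    using assms(1)
  proof (induction N arbitrary: f a)
    case 0
    have "((\<lambda>z. f z / g z) \<longlongrightarrow> of_real (fps_nth a 0) / of_real (fps_nth b 0)) (sector_at_infinity \<epsilon>)"
      using assms(3) by (intro tendsto_divide expands_tendsto[OF 0 \<open>0 < \<epsilon>\<close>] lim_g) auto
    then have "(\<lambda>z. f z / g z) \<in> O[sector_at_infinity \<epsilon>](\<lambda>_. 1)"
      by (intro bigoI_tendsto[where c = "of_real (fps_nth a 0) / of_real (fps_nth b 0)"]) auto
    then show ?case by simp
  next
    case (Suc N)
    define q where "q = fps_nth a 0 / fps_nth b 0"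
    define a' where "a' = a - fps_const q * b"
    define f' where "f' = (\<lambda>z. f z - of_real q * g z)"
    have f': "expands f' a'"
      using expands_add[OF Suc.prems expands_cmult[OF assms(2), of "- q"]]
      by (simp add: f'_def a'_def fps_const_neg[symmetric] del: fps_const_neg)
    have a'0: "fps_nth a' 0 = 0" using assms(3) by (simp add: a'_def q_def)
    have shift: "fps_nth (fps_shift 1 a' / b) j = fps_nth (a / b) (Suc j)" for j
    proof -
      have "a / b = a' / b + fps_const q"
        using assms(3) by (simp add: a'_def fps_divide_unit algebra_simps inverse_mult_eq_1')
      moreover have "a' / b = fps_X * (fps_shift 1 a' / b)"
      proof -
        have "a' = fps_X * fps_shift 1 a'"
          using a'0 by (intro fps_ext) (auto simp: not_less_eq_eq)
        then show ?thesis using assms(3) by (metis fps_divide_unit mult.assoc)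
      qed
      ultimately show ?thesis by simp
    qed
    have zero: "fps_nth (a / b) 0 = q"
      using assms(3) by (simp add: q_def fps_divide_unit divide_inverse)
    have "(\<lambda>z. z * f' z / g z - (\<Sum>j<N. of_real (fps_nth (fps_shift 1 a' / b) j) / z ^ j))
      \<in> O[sector_at_infinity \<epsilon>](\<lambda>z. 1 / z ^ N)"
      using Suc.IH[OF expands_times[OF f' a'0]] .
    then have "(\<lambda>z. (1 / z) * (z * f' z / g z - (\<Sum>j<N. of_real (fps_nth (fps_shift 1 a' / b) j) / z ^ j)))
      \<in> O[sector_at_infinity \<epsilon>](\<lambda>z. (1 / z) * (1 / z ^ N))"
      by (intro landau_o.big.mult landau_o.big_refl)
    also have "?this \<longleftrightarrow> (\<lambda>z. f z / g z - (\<Sum>j<Suc N. of_real (fps_nth (a / b) j) / z ^ j))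
      \<in> O[sector_at_infinity \<epsilon>](\<lambda>z. 1 / z ^ Suc N)"
    proof (rule landau_o.big.cong_ex)
      show "\<forall>\<^sub>F z in sector_at_infinity \<epsilon>.
          (1 / z) * (z * f' z / g z - (\<Sum>j<N. of_real (fps_nth (fps_shift 1 a' / b) j) / z ^ j))
        = f z / g z - (\<Sum>j<Suc N. of_real (fps_nth (a / b) j) / z ^ j)"
        using eventually_sector_nonzero g_nz
      proof eventually_elim
        case (elim z)
        have "f z / g z = q + f' z / g z" using elim by (simp add: f'_def field_simps)
        then show ?case
          unfolding sum.lessThan_Suc_shift shift using elim
          by (simp add: zero right_diff_distrib sum_distrib_left)
      qed
      show "\<forall>\<^sub>F z::complex in sector_at_infinity \<epsilon>. (1 / z) * (1 / z ^ N) = 1 / z ^ Suc N"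
        by simp
    qed
    finally show ?case .
  qed
qed

lemma expands_divide_shifted:
  assumes f: "expands f a" "\<forall>i<n + k. fps_nth a i = 0"
    and g: "expands g b" "\<forall>i<n. fps_nth b i = 0" "fps_nth b n \<noteq> 0"
  obtains q where "expands (\<lambda>z. f z / g z) q" "\<forall>i<k. fps_nth q i = 0"
    "fps_nth q k = fps_nth a (n + k) / fps_nth b n"
proof -
  let ?q = "fps_shift (n + k) a / fps_shift n b"
  have "expands (\<lambda>z. (z ^ (n + k) * f z) / (z ^ n * g z)) ?q"
    using f g by (intro expands_divide expands_times_power) auto
  from expands_over_power[OF this, of k]
  have "expands (\<lambda>z. f z / g z) (fps_X ^ k * ?q)"
  proof (rule expands_cong)
    fix \<epsilon> :: real
    show "\<forall>\<^sub>F z in sector_at_infinity \<epsilon>. z ^ (n + k) * f z / (z ^ n * g z) / z ^ k = f z / g z"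
      using eventually_sector_nonzero by eventually_elim (simp add: power_add)
  qed
  moreover have "fps_nth ?q 0 = fps_nth a (n + k) / fps_nth b n"
    using g(3) by (simp add: fps_divide_unit divide_inverse)
  ultimately show ?thesis
    by (intro that[of "fps_X ^ k * ?q"]) (auto simp: fps_X_power_mult_nth)
qed

text \<open>The series of \<open>- s\<^sub>0/z - s\<^sub>1/z^2 - ...\<close>; its constant term is \<open>0\<close>.\<close>

definition moment_fps :: "(nat \<Rightarrow> real) \<Rightarrow> real fps" where
  "moment_fps s = Abs_fps (\<lambda>j. if j = 0 then 0 else - s (j - 1))"

lemma moment_fps_nth [simp]:
  "fps_nth (moment_fps s) 0 = 0" "fps_nth (moment_fps s) (Suc j) = - s j"
  by (simp_all add: moment_fps_def)

lemma moment_fps_sum: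
  "(\<Sum>j<Suc N. of_real (fps_nth (moment_fps s) j) / z ^ j) = - (\<Sum>j<N. complex_of_real (s j) / z ^ (j + 1))"
  unfolding sum.lessThan_Suc_shift by (simp add: sum_negf)

text \<open>
  The little-o condition is imposed only at odd orders. It follows from the big-O condition for one
  more term; conversely, the big-O condition at a given order follows from the little-o condition
  for a longer expansion, whose surplus terms are absorbed in the error.
\<close>

lemma asymptotic_expansion_iff_expands:
  "asymptotic_expansion f s \<longleftrightarrow> expands f (moment_fps s)"
proof
  assume *: "expands f (moment_fps s)"
  show "asymptotic_expansion f s"
    unfolding asymptotic_expansion_def
  proof (intro allI impI)
    fix \<epsilon> :: real and n assume "0 < \<epsilon>"
    with * have "(\<lambda>z. f z - (\<Sum>j<Suc (Suc (2 * n)). of_real (fps_nth (moment_fps s) j) / z ^ j))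
        \<in> O[sector_at_infinity \<epsilon>](\<lambda>z. 1 / z ^ Suc (Suc (2 * n)))"
      unfolding expands_def by blast
    also have "(\<lambda>z. 1 / z ^ Suc (Suc (2 * n))) \<in> o[sector_at_infinity \<epsilon>](\<lambda>z. 1 / z ^ (2 * n + 1))"
      by (rule sector_power_smallo) simp
    finally show "(\<lambda>z. f z + (\<Sum>j\<le>2 * n. of_real (s j) / z ^ (j + 1)))
        \<in> o[sector_at_infinity \<epsilon>](\<lambda>z. 1 / z ^ (2 * n + 1))"
      unfolding moment_fps_sum by (simp only: lessThan_Suc_atMost diff_minus_eq_add)
  qed
next
  assume *: "asymptotic_expansion f s"
  show "expands f (moment_fps s)"
    unfolding expands_def
  proof (intro allI impI)
    fix \<epsilon> :: real and N assume "0 < \<epsilon>"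
    let ?c = "\<lambda>j. complex_of_real (fps_nth (moment_fps s) j)"
    have "(\<lambda>z. f z - (\<Sum>j<Suc (Suc (2 * N)). ?c j / z ^ j))
        \<in> o[sector_at_infinity \<epsilon>](\<lambda>z. 1 / z ^ (2 * N + 1))"
      using * \<open>0 < \<epsilon>\<close> unfolding moment_fps_sum asymptotic_expansion_def
      by (simp only: lessThan_Suc_atMost diff_minus_eq_add)
    then have "(\<lambda>z. f z - (\<Sum>j<Suc (Suc (2 * N)). ?c j / z ^ j))
        \<in> O[sector_at_infinity \<epsilon>](\<lambda>z. 1 / z ^ N)"
      using landau_o.big_trans[OF landau_o.small_imp_big sector_power_bigo[of N "2 * N + 1"]] by simp
    moreover have "(\<lambda>z. \<Sum>j\<in>{N..<Suc (Suc (2 * N))}. ?c j * (1 / z ^ j))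
        \<in> O[sector_at_infinity \<epsilon>](\<lambda>z. 1 / z ^ N)"
    proof (rule big_sum_in_bigo)
      fix j assume "j \<in> {N..<Suc (Suc (2 * N))}"
      then show "(\<lambda>z. ?c j * (1 / z ^ j)) \<in> O[sector_at_infinity \<epsilon>](\<lambda>z. 1 / z ^ N)"
        using sector_power_bigo[of N j \<epsilon>] by (cases "?c j = 0") (simp_all del: times_divide_eq_right)
    qed
    ultimately have "(\<lambda>z. (f z - (\<Sum>j<Suc (Suc (2 * N)). ?c j / z ^ j))
        + (\<Sum>j\<in>{N..<Suc (Suc (2 * N))}. ?c j * (1 / z ^ j))) \<in> O[sector_at_infinity \<epsilon>](\<lambda>z. 1 / z ^ N)"
      by (rule sum_in_bigo(1))
    moreover have "(\<Sum>j<Suc (Suc (2 * N)). ?c j / z ^ j)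
       = (\<Sum>j<N. ?c j / z ^ j) + (\<Sum>j\<in>{N..<Suc (Suc (2 * N))}. ?c j / z ^ j)" for z
      unfolding lessThan_atLeast0 by (rule sum.atLeastLessThan_concat[symmetric]) auto
    ultimately show "(\<lambda>z. f z - (\<Sum>j<N. ?c j / z ^ j)) \<in> O[sector_at_infinity \<epsilon>](\<lambda>z. 1 / z ^ N)"
      by (simp add: algebra_simps)
  qed
qed

lemma expands_eventually_nonzero:
  assumes "expands f a" "\<forall>i<n. fps_nth a i = 0" "fps_nth a n \<noteq> 0" "0 < \<epsilon>"
  shows "\<forall>\<^sub>F z in sector_at_infinity \<epsilon>. f z \<noteq> 0"
proof -
  have "((\<lambda>z. z ^ n * f z) \<longlongrightarrow> of_real (fps_nth (fps_shift n a) 0)) (sector_at_infinity \<epsilon>)"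
    by (rule expands_tendsto[OF expands_times_power[OF assms(1,2)] assms(4)])
  then have "\<forall>\<^sub>F z in sector_at_infinity \<epsilon>. z ^ n * f z \<noteq> 0"
    by (rule tendsto_imp_eventually_ne) (use assms(3) in simp)
  then show ?thesis by eventually_elim auto
qed

section \<open>Block matrices with blocks of size one or two\<close>

lemma block_of_eqI:
  assumes "strict_mono n" "n j \<le> i" "i < n (Suc j)"
  shows "block_of n i = j"
  unfolding block_of_def
proof (rule the_equality)
  fix j' assume j': "n j' \<le> i \<and> i < n (Suc j')"
  have "\<not> Suc j \<le> j'" "\<not> Suc j' \<le> j"
    using assms j' strict_mono_less_eq[OF assms(1)] by (metis le_trans not_le)+
  then show "j' = j" by simp
qed (use assms in simp)

lemma block_exists:
  assumes "strict_mono n" "n 0 = (0::nat)"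
  obtains j where "n j \<le> i" "i < n (Suc j)"
proof -
  have "i < n (Suc i)" using strict_mono_imp_increasing[OF assms(1), of "Suc i"] by simp
  then have "\<exists>j. i < n (Suc j)" ..
  define j where "j = (LEAST j. i < n (Suc j))"
  have "i < n (Suc j)" unfolding j_def by (rule LeastI_ex) fact
  moreover have "n j \<le> i"
  proof (cases j)
    case (Suc j')
    then have "\<not> i < n (Suc j')" using not_less_Least[of j' "\<lambda>j. i < n (Suc j)"] by (simp add: j_def)
    then show ?thesis by (simp add: Suc)
  qed (simp add: assms)
  ultimately show ?thesis by (intro that)
qed

text \<open>
  Block \<open>j\<close> occupies the indices \<open>n j, ..., n j + k j - 1\<close>. An index is written as \<open>n j + a\<close> with
  \<open>a < k j\<close>, which determines \<open>j\<close> and \<open>a\<close>.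
\<close>

locale block_partition =
  fixes n :: "nat \<Rightarrow> nat" and k :: "nat \<Rightarrow> nat"
  assumes n_0: "n 0 = 0" and n_Suc: "n (Suc j) = n j + k j" and k_cases: "k j = 1 \<or> k j = 2"
begin

lemma k_pos: "0 < k j"
  using k_cases[of j] by auto

lemma strict_mono_n: "strict_mono n"
  by (rule strict_monoI_Suc) (simp add: n_Suc k_pos)

lemma n_eq_iff: "n i = n j \<longleftrightarrow> i = j"
  using strict_mono_n strict_mono_eq by blast

lemma index_cases:
  obtains j a where "r = n j + a" "a < k j"
proof -
  obtain j where "n j \<le> r" "r < n (Suc j)" using block_exists[OF strict_mono_n n_0] .
  then show ?thesis by (intro that[of j "r - n j"]) (auto simp: n_Suc)
qed

lemma block_of_index: "a < k j \<Longrightarrow> block_of n (n j + a) = j"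
  by (rule block_of_eqI[OF strict_mono_n]) (auto simp: n_Suc)

lemma block_tridiagonal_index:
  assumes "a < k i" "b < k j"
  shows "block_tridiagonal n lo di up (n i + a) (n j + b) =
    (if i = j then di i a b else if j = Suc i then up i a b else if i = Suc j then lo j a b else 0)"
  using assms by (simp add: block_tridiagonal_def block_of_index)

text \<open>The two factors of a block LU-factorization.\<close>

definition L_matrix :: "(nat \<Rightarrow> real) \<Rightarrow> inf_matrix" where
  "L_matrix l = block_tridiagonal n (\<lambda>j. upper_left_block (l (Suc j))) (\<lambda>j. identity_block) (\<lambda>j a b. 0)"

definition U_matrix :: "(nat \<Rightarrow> real) \<Rightarrow> (nat \<Rightarrow> real) \<Rightarrow> inf_matrix" where
  "U_matrix u\<^sub>0 u\<^sub>1 = block_tridiagonal n (\<lambda>j a b. 0)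
     (\<lambda>j. diagonal_block (k j) (u\<^sub>0 j) (u\<^sub>1 j)) (\<lambda>j. lower_left_block (k j) 1)"

lemma L_matrix_index:
  assumes "a < k i" "b < k j"
  shows "L_matrix l (n i + a) (n j + b) =
    (if i = j \<and> a = b then 1 else if i = Suc j \<and> a = 0 \<and> b = 0 then l (Suc j) else 0)"
  using assms by (auto simp: L_matrix_def block_tridiagonal_index identity_block_def upper_left_block_def)

text \<open>
  Besides the identity, \<open>L\<close> has only the entries \<open>l (Suc j)\<close> at \<open>(n (Suc j), n j)\<close>. Multiplication by
  \<open>L\<close> from the right is therefore a column operation, and from the left a row operation, with a
  single correction term.
\<close>

lemma mult_L_matrix:
  assumes "b < k j"
  shows "inf_matrix_mult X (L_matrix l) r (n j + b) =
    X r (n j + b) + (if b = 0 then X r (n (Suc j)) * l (Suc j) else 0)"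
proof -
  let ?L = "L_matrix l"
  have zero: "?L m (n j + b) = 0" if "m \<noteq> n j + b" "m \<noteq> n (Suc j)" for m
  proof -
    obtain i a where "m = n i + a" "a < k i" by (rule index_cases)
    with that assms show ?thesis by (auto simp: L_matrix_index)
  qed
  have ne: "n j + b \<noteq> n (Suc j)" using assms by (simp add: n_Suc)
  have "inf_matrix_mult X ?L r (n j + b) =
      (\<Sum>m\<in>{n j + b, n (Suc j)}. X r m * ?L m (n j + b))"
    unfolding inf_matrix_mult_def using zero by (intro Sum_any.expand_superset) auto
  also have "\<dots> = X r (n j + b) * ?L (n j + b) (n j + b)
      + X r (n (Suc j)) * ?L (n (Suc j) + 0) (n j + b)"
    using ne by simp
  also have "?L (n j + b) (n j + b) = 1"
    using assms by (simp add: L_matrix_index)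
  also have "?L (n (Suc j) + 0) (n j + b) = (if b = 0 then l (Suc j) else 0)"
    using assms k_pos by (subst L_matrix_index) auto
  finally show ?thesis by simp
qed

lemma L_matrix_mult_below:
  "inf_matrix_mult (L_matrix l) X (n (Suc j)) c = X (n (Suc j)) c + l (Suc j) * X (n j) c"
proof -
  let ?L = "L_matrix l" and ?r = "n (Suc j)"
  have zero: "?L ?r m = 0" if "m \<noteq> ?r" "m \<noteq> n j" for m
  proof -
    obtain i a where "m = n i + a" "a < k i" by (rule index_cases)
    with that k_pos L_matrix_index[of 0 "Suc j" a i l] show ?thesis by auto
  qed
  have "inf_matrix_mult ?L X ?r c = (\<Sum>m\<in>{?r, n j}. ?L ?r m * X m c)"
    unfolding inf_matrix_mult_def using zero by (intro Sum_any.expand_superset) auto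
  also have "\<dots> = ?L (?r + 0) (?r + 0) * X ?r c + ?L (?r + 0) (n j + 0) * X (n j) c"
    using n_eq_iff[of "Suc j" j] by simp
  finally show ?thesis using k_pos by (subst (asm) (1 2) L_matrix_index) auto
qed

lemma L_matrix_mult_other:
  assumes "a < k i" "a \<noteq> 0 \<or> i = 0"
  shows "inf_matrix_mult (L_matrix l) X (n i + a) c = X (n i + a) c"
proof -
  let ?L = "L_matrix l" and ?r = "n i + a"
  have zero: "?L ?r m = 0" if "m \<noteq> ?r" for m
  proof -
    obtain j b where "m = n j + b" "b < k j" by (rule index_cases)
    with that assms show ?thesis by (auto simp: L_matrix_index)
  qed
  have "inf_matrix_mult ?L X ?r c = (\<Sum>m\<in>{?r}. ?L ?r m * X m c)"
    unfolding inf_matrix_mult_def using zero by (intro Sum_any.expand_superset) auto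
  also have "\<dots> = X ?r c" using assms(1) by (simp add: L_matrix_index)
  finally show ?thesis .
qed

lemma U_matrix_index:
  assumes "a < k i" "b < k j"
  shows "U_matrix u\<^sub>0 u\<^sub>1 (n i + a) (n j + b) =
    (if i = j then diagonal_block (k i) (u\<^sub>0 i) (u\<^sub>1 i) a b
     else if j = Suc i \<and> a = k i - 1 \<and> b = 0 then 1 else 0)"
  using assms by (simp add: U_matrix_def block_tridiagonal_index lower_left_block_def)

lemma UL_matrix:
  "inf_matrix_mult (U_matrix u\<^sub>0 u\<^sub>1) (L_matrix l) =
     block_tridiagonal n
       (\<lambda>j. lower_left_block (k (Suc j)) (u\<^sub>0 (Suc j) * l (Suc j)))
       (\<lambda>j. diagonal_block (k j) (u\<^sub>0 j + l (Suc j)) (u\<^sub>1 j))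
       (\<lambda>j. lower_left_block (k j) 1)" (is "?M = ?T")
proof (intro ext)
  fix r c
  obtain i a where r: "r = n i + a" "a < k i" by (rule index_cases)
  obtain j b where c: "c = n j + b" "b < k j" by (rule index_cases)
  have "?M r c = U_matrix u\<^sub>0 u\<^sub>1 (n i + a) (n j + b)
      + (if b = 0 then U_matrix u\<^sub>0 u\<^sub>1 (n i + a) (n (Suc j) + 0) * l (Suc j) else 0)"
    using mult_L_matrix[OF c(2)] by (simp add: r c)
  also have "\<dots> = ?T r c"
    unfolding r c
    using r(2) c(2) k_cases[of i] k_cases[of j] k_pos
    by (subst (1 2) U_matrix_index)
      (auto simp: block_tridiagonal_index lower_left_block_def diagonal_block_def less_2_cases_iff)
  finally show "?M r c = ?T r c" .
qed

text \<open>
  The entries of \<open>J = LU\<close> that express \<open>b\<close> and \<open>c\<close> through the factors. The first block has no block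
  to its left, so \<open>b 0\<close> receives no contribution from \<open>l\<close>.
\<close>

lemma LU_entries:
  assumes "monic_Jacobi_matrix b c = inf_matrix_mult (L_matrix l) (U_matrix u\<^sub>0 u\<^sub>1)"
  shows "k j = 1 \<Longrightarrow> c (n j) = l (Suc j) * u\<^sub>0 j"
    and "k j = 2 \<Longrightarrow> c (n j) = u\<^sub>0 j"
    and "k j = 2 \<Longrightarrow> c (Suc (n j)) = l (Suc j)"
    and "k j = 2 \<Longrightarrow> b (Suc (n j)) = u\<^sub>1 j"
    and "b 0 = (if k 0 = 1 then u\<^sub>0 0 else 0)"
    and "b (n (Suc j)) = (if k (Suc j) = 1 then u\<^sub>0 (Suc j) else 0) + (if k j = 1 then l (Suc j) else 0)"
proof -
  let ?U = "U_matrix u\<^sub>0 u\<^sub>1"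
  have J: "inf_matrix_mult (L_matrix l) ?U r m =
      (if r = m then b r else if m = Suc r then 1 else if r = Suc m then c m else 0)" for r m
    using assms by (metis monic_Jacobi_matrix_def)
  have below: "inf_matrix_mult (L_matrix l) ?U (n (Suc j)) m
      = ?U (n (Suc j) + 0) m + l (Suc j) * ?U (n j + 0) m" for m
    using L_matrix_mult_below by simp
  show "k j = 1 \<Longrightarrow> c (n j) = l (Suc j) * u\<^sub>0 j"
  proof -
    assume k: "k j = 1"
    then have "c (n j) = inf_matrix_mult (L_matrix l) ?U (n (Suc j)) (n j)"
      by (simp add: J n_Suc)
    also have "\<dots> = ?U (n (Suc j) + 0) (n j + 0) + l (Suc j) * ?U (n j + 0) (n j + 0)"
      using below by simp
    finally show ?thesis
      using k k_pos by (subst (asm) (1 2) U_matrix_index) (auto simp: diagonal_block_def)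
  qed
  show "k j = 2 \<Longrightarrow> c (n j) = u\<^sub>0 j"
  proof -
    assume k: "k j = 2"
    have "c (n j) = inf_matrix_mult (L_matrix l) ?U (n j + 1) (n j)"
      by (simp add: J)
    also have "\<dots> = ?U (n j + 1) (n j + 0)"
      using k by (subst L_matrix_mult_other) auto
    finally show ?thesis
      using k by (subst (asm) U_matrix_index) (auto simp: diagonal_block_def)
  qed
  show "k j = 2 \<Longrightarrow> c (Suc (n j)) = l (Suc j)"
  proof -
    assume k: "k j = 2"
    then have "c (Suc (n j)) = inf_matrix_mult (L_matrix l) ?U (n (Suc j)) (n j + 1)"
      by (simp add: J n_Suc)
    also have "\<dots> = ?U (n (Suc j) + 0) (n j + 1) + l (Suc j) * ?U (n j + 0) (n j + 1)"
      using below by simp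
    finally show ?thesis
      using k k_pos by (subst (asm) (1 2) U_matrix_index) (auto simp: diagonal_block_def)
  qed
  show "k j = 2 \<Longrightarrow> b (Suc (n j)) = u\<^sub>1 j"
  proof -
    assume k: "k j = 2"
    have "b (Suc (n j)) = inf_matrix_mult (L_matrix l) ?U (n j + 1) (n j + 1)"
      by (simp add: J)
    also have "\<dots> = ?U (n j + 1) (n j + 1)"
      using k by (subst L_matrix_mult_other) auto
    finally show ?thesis
      using k by (subst (asm) U_matrix_index) (auto simp: diagonal_block_def)
  qed
  show "b 0 = (if k 0 = 1 then u\<^sub>0 0 else 0)"
  proof -
    have "b 0 = inf_matrix_mult (L_matrix l) ?U (n 0 + 0) (n 0 + 0)"
      by (simp add: J n_0)
    also have "\<dots> = ?U (n 0 + 0) (n 0 + 0)"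
      using k_pos by (subst L_matrix_mult_other) auto
    finally show ?thesis
      using k_pos by (subst (asm) U_matrix_index) (auto simp: diagonal_block_def)
  qed
  show "b (n (Suc j)) = (if k (Suc j) = 1 then u\<^sub>0 (Suc j) else 0) + (if k j = 1 then l (Suc j) else 0)"
  proof -
    have "b (n (Suc j)) = inf_matrix_mult (L_matrix l) ?U (n (Suc j)) (n (Suc j))"
      by (simp add: J)
    also have "\<dots> = ?U (n (Suc j) + 0) (n (Suc j) + 0) + l (Suc j) * ?U (n j + 0) (n (Suc j) + 0)"
      using below by simp
    finally show ?thesis
      using k_pos k_cases[of j] by (subst (asm) (1 2) U_matrix_index) (auto simp: diagonal_block_def)
  qed
qed

end

text \<open>
  If of any two consecutive positive integers at least one is a normal index, then there are
  infinitely many normal indices and all gaps are \<open>1\<close> or \<open>2\<close>.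
\<close>

lemma normal_index_partition:
  assumes inf: "\<And>m. Suc m \<in> normal_indices s \<or> Suc (Suc m) \<in> normal_indices s"
  shows "block_partition (normal_index s) (normal_gap s)"
proof -
  let ?N = "normal_indices s"
  have infinite: "infinite ?N"
    unfolding infinite_nat_iff_unbounded using inf by (meson lessI less_SucI less_trans)
  have step: "normal_index s j < normal_index s (Suc j) \<and> normal_index s (Suc j) \<le> normal_index s j + 2" for j
  proof (cases j)
    case 0
    have pos: "0 < enumerate ?N 0"
      using enumerate_in_set[OF infinite, of 0] by (simp add: normal_indices_def)
    have "enumerate ?N 0 \<le> m" if "m \<in> ?N" for m
      using that by (simp add: enumerate_0 Least_le)
    moreover obtain m where "m \<in> ?N" "m \<le> 2"
      using inf[of 0] by force
    ultimately have "enumerate ?N 0 \<le> 2" by (meson le_trans)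
    then show ?thesis using pos by (simp add: 0)
  next
    case (Suc i)
    let ?m = "enumerate ?N i"
    have "enumerate ?N (Suc i) \<le> m" if "m \<in> ?N" "?m < m" for m
      unfolding enumerate_Suc''[OF infinite] using that by (intro Least_le) auto
    moreover obtain m where "m \<in> ?N" "?m < m" "m \<le> ?m + 2"
      using inf[of ?m] by force
    ultimately have "enumerate ?N (Suc i) \<le> ?m + 2" by (meson le_trans)
    then show ?thesis using enumerate_step[OF infinite, of i] by (simp add: Suc)
  qed
  show ?thesis
  proof
    fix j
    show "normal_index s (Suc j) = normal_index s j + normal_gap s j"
      using step[of j] by (simp add: normal_gap_def del: normal_index.simps)
    show "normal_gap s j = 1 \<or> normal_gap s j = 2"
      using step[of j] by (auto simp add: normal_gap_def simp del: normal_index.simps)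
  qed simp
qed

section \<open>Orthogonal polynomials and the normal indices of the shifted moments\<close>

text \<open>
  The assumption \<open>nonnull\<close> says that \<open>\<sigma>\<close> has positive total mass; the mass is finite because
  \<open>t ^ 0\<close> is integrable.
\<close>

locale orthogonal_polynomials =
  fixes \<sigma> :: "real measure" and P :: "nat \<Rightarrow> real poly" and b c :: "nat \<Rightarrow> real"
  assumes sets: "sets \<sigma> = sets borel"
    and nonnull: "measure \<sigma> (space \<sigma>) \<noteq> 0"
    and integrable_power: "integrable \<sigma> (\<lambda>t. t ^ j)"
    and degree_P: "degree (P j) = j"
    and lead_coeff_P: "lead_coeff (P j) = 1"
    and orthogonal: "i \<noteq> j \<Longrightarrow> (LINT t|\<sigma>. poly (P i) t * poly (P j) t) = 0"
    and recurrence: "[:0, 1:] * P j = P (Suc j) + Polynomial.smult (b j) (P j)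
                + (if j = 0 then 0 else Polynomial.smult (c (j - 1)) (P (j - 1)))"
    and c_pos: "0 < c j"
begin

text \<open>The moment functional.\<close>

definition mean :: "real poly \<Rightarrow> real" where
  "mean q = (LINT t|\<sigma>. poly q t)"

definition moment :: "nat \<Rightarrow> real" where
  "moment j = mean (monom 1 j)"

text \<open>The squared norm of \<open>P j\<close>.\<close>

definition h :: "nat \<Rightarrow> real" where
  "h j = mean (P j * P j)"

lemma integrable_poly [simp]: "integrable \<sigma> (poly q)"
proof -
  have "integrable \<sigma> (\<lambda>t. \<Sum>i\<le>degree q. coeff q i * t ^ i)"
    by (intro Bochner_Integration.integrable_sum integrable_mult_right integrable_power)
  then show ?thesis by (simp add: poly_altdef[abs_def])
qed

lemma mean_add: "mean (p + q) = mean p + mean q"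
  by (simp add: mean_def)

lemma mean_diff: "mean (p - q) = mean p - mean q"
  by (simp add: mean_def)

lemma mean_smult: "mean (Polynomial.smult x q) = x * mean q"
  by (simp add: mean_def)

lemma mean_0 [simp]: "mean 0 = 0"
  by (simp add: mean_def)

lemma mean_sum: "mean (\<Sum>i\<in>A. f i) = (\<Sum>i\<in>A. mean (f i))"
  by (induction A rule: infinite_finite_induct) (simp_all add: mean_add)

lemma mean_mult_P_P: "mean (P i * P j) = (if i = j then h j else 0)"
  using orthogonal[of i j] by (simp add: mean_def h_def)

lemma P_0: "P 0 = 1"
proof -
  obtain x where "P 0 = [:x:]" using degree_P[of 0] by (rule degree_eq_zeroE)
  then show ?thesis using lead_coeff_P[of 0] by (simp add: one_pCons)
qed

lemma degree_minus_leading_P: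
  assumes "degree q \<le> j" "q - Polynomial.smult (coeff q j) (P j) \<noteq> 0"
  shows "degree (q - Polynomial.smult (coeff q j) (P j)) < j"
proof -
  let ?r = "q - Polynomial.smult (coeff q j) (P j)"
  have 1: "coeff ?r i = 0" if "j \<le> i" for i
  proof (cases "i = j")
    case True
    then show ?thesis using lead_coeff_P[of j] by (simp add: degree_P)
  next
    case False
    then show ?thesis using that assms(1) by (simp add: coeff_eq_0 degree_P)
  qed
  show ?thesis
  proof (rule ccontr)
    assume "\<not> degree ?r < j"
    then have "lead_coeff ?r = 0" by (intro 1) (simp only: not_less)
    with assms(2) show False by (simp only: leading_coeff_0_iff)
  qed
qed

lemma mean_mult_P_less:
  assumes "degree q < j"
  shows "mean (q * P j) = 0"
  using assms
proof (induction "degree q" arbitrary: q rule: less_induct)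
  case less
  let ?r = "q - Polynomial.smult (lead_coeff q) (P (degree q))"
  have "mean (?r * P j) = 0"
  proof (cases "?r = 0")
    case False
    then have "degree ?r < degree q" by (intro degree_minus_leading_P) auto
    with less show ?thesis by simp
  qed simp
  moreover have "q = Polynomial.smult (lead_coeff q) (P (degree q)) + ?r" by simp
  then have "mean (q * P j) = lead_coeff q * mean (P (degree q) * P j) + mean (?r * P j)"
    by (metis distrib_right mean_add mean_smult mult_smult_left)
  ultimately show ?case using less.prems by (simp add: mean_mult_P_P)
qed

lemma mean_mult_P:
  assumes "degree q \<le> j"
  shows "mean (q * P j) = coeff q j * h j"
proof -
  let ?r = "q - Polynomial.smult (coeff q j) (P j)"
  have "mean (?r * P j) = 0"
    using degree_minus_leading_P[OF assms] mean_mult_P_less[of ?r j] by (cases "?r = 0") auto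
  moreover have "q = Polynomial.smult (coeff q j) (P j) + ?r" by simp
  then have "mean (q * P j) = coeff q j * mean (P j * P j) + mean (?r * P j)"
    by (metis distrib_right mean_add mean_smult mult_smult_left)
  ultimately show ?thesis by (simp add: mean_mult_P_P)
qed

lemma h_0: "h 0 = moment 0"
  by (simp add: h_def moment_def P_0)

lemma moment_0_pos: "0 < moment 0"
  using nonnull by (simp add: moment_def mean_def zero_less_measure_iff)

lemma h_Suc: "h (Suc j) = c j * h j"
proof -
  have "mean (([:0, 1:] * P j) * P (Suc j)) = h (Suc j)"
    unfolding recurrence[of j]
    by (simp add: distrib_right mean_add mean_smult mean_mult_P_P)
  moreover have "mean (([:0, 1:] * P (Suc j)) * P j) = c j * h j"
    unfolding recurrence[of "Suc j"]
    by (simp add: distrib_right mean_add mean_smult mean_mult_P_P)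
  moreover have "([:0, 1:] * P j) * P (Suc j) = ([:0, 1:] * P (Suc j)) * P j"
    by (simp only: mult_ac)
  ultimately show ?thesis by metis
qed

lemma h_pos: "0 < h j"
  by (induction j) (simp_all add: h_0 moment_0_pos h_Suc c_pos)

text \<open>
  A vector in the kernel of the shifted Hankel matrix is the coefficient vector of a polynomial
  \<open>V \<noteq> 0\<close> of degree below \<open>n\<close> for which \<open>x * V\<close> is orthogonal to all polynomials of degree below \<open>n\<close>.
  Hence \<open>x * V\<close> is a nonzero multiple of \<open>P n\<close>, which must vanish at \<open>0\<close>.
\<close>

lemma poly_P_0_eq_0:
  assumes "Determinant.det (Matrix.mat n n (\<lambda>(i, k). moment (i + k + 1))) = 0"
  shows "poly (P n) 0 = 0"
proof -
  let ?A = "Matrix.mat n n (\<lambda>(i, k). moment (i + k + 1))"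
  obtain v where v: "v \<in> carrier_vec n" "v \<noteq> 0\<^sub>v n" "?A *\<^sub>v v = 0\<^sub>v n"
    using assms det_0_iff_vec_prod_zero[of ?A n] by auto
  define V where "V = (\<Sum>k<n. monom (vec_index v k) k)"
  define W where "W = [:0, 1:] * V"
  have coeff_V: "coeff V k = (if k < n then vec_index v k else 0)" for k
    by (simp add: V_def coeff_sum)
  have coeff_W: "coeff W k = (case k of 0 \<Rightarrow> 0 | Suc k \<Rightarrow> coeff V k)" for k
    by (simp add: W_def coeff_pCons split: nat.split)
  have deg_W: "degree W \<le> n"
    by (rule degree_le) (auto simp: coeff_W coeff_V split: nat.split)
  have "\<exists>k<n. vec_index v k \<noteq> 0"
  proof (rule ccontr)
    assume "\<not> (\<exists>k<n. vec_index v k \<noteq> 0)"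
    then have "v = 0\<^sub>v n" using v(1) by (intro eq_vecI) auto
    with v(2) show False ..
  qed
  then have "V \<noteq> 0" using coeff_V by (metis coeff_0)
  then have "W \<noteq> 0" by (simp add: W_def)
  have monom_W: "mean (monom 1 i * W) = 0" if "i < n" for i
  proof -
    have "monom 1 i * W = (\<Sum>k<n. Polynomial.smult (vec_index v k) (monom 1 (i + k + 1)))"
    proof -
      have "W = monom 1 1 * V" by (simp add: W_def monom_altdef)
      then show ?thesis
        by (simp add: V_def sum_distrib_left mult_monom smult_monom add_ac)
    qed
    then have "mean (monom 1 i * W) = (\<Sum>k<n. vec_index v k * moment (i + k + 1))"
      by (simp add: mean_sum mean_smult moment_def)
    also have "\<dots> = vec_index (?A *\<^sub>v v) i"
      using that v(1) by (simp add: scalar_prod_def lessThan_atLeast0 mult.commute)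
    also have "\<dots> = 0" using v(3) that by simp
    finally show ?thesis .
  qed
  have low_W: "mean (q * W) = 0" if "degree q < n" for q
  proof -
    have "q * W = (\<Sum>i\<le>degree q. Polynomial.smult (coeff q i) (monom 1 i * W))"
      by (subst (1) poly_as_sum_of_monoms[symmetric, of q])
        (simp add: sum_distrib_right smult_monom flip: mult_smult_left)
    then show ?thesis using that by (simp add: mean_sum mean_smult monom_W)
  qed
  have "W = Polynomial.smult (coeff W n) (P n)"
  proof (rule ccontr)
    let ?r = "W - Polynomial.smult (coeff W n) (P n)"
    assume "W \<noteq> Polynomial.smult (coeff W n) (P n)"
    then have "?r \<noteq> 0" by simp
    then have deg: "degree ?r < n" using deg_W by (intro degree_minus_leading_P) auto
    have "lead_coeff ?r * h (degree ?r) = mean (?r * P (degree ?r))"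
      by (simp add: mean_mult_P)
    also have "\<dots> = mean (P (degree ?r) * W) - coeff W n * mean (P (degree ?r) * P n)"
      by (simp add: algebra_simps mean_diff mean_smult)
    also have "\<dots> = 0" using deg by (simp add: low_W degree_P mean_mult_P_P)
    finally show False using \<open>?r \<noteq> 0\<close> h_pos[of "degree ?r"]
      by (metis leading_coeff_0_iff mult_eq_0_iff less_irrefl)
  qed
  moreover have "poly W 0 = 0" by (simp add: W_def)
  ultimately have "coeff W n * poly (P n) 0 = 0" by (metis poly_smult)
  moreover have "coeff W n \<noteq> 0"
    using \<open>W \<noteq> 0\<close> \<open>W = Polynomial.smult (coeff W n) (P n)\<close> by (metis smult_0_left)
  ultimately show ?thesis by simp
qed

text \<open>Two consecutive zeros at \<open>0\<close> would propagate down the recurrence to \<open>P 0 = 1\<close>.\<close>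

lemma poly_P_0_consecutive: "poly (P n) 0 \<noteq> 0 \<or> poly (P (Suc n)) 0 \<noteq> 0"
proof (induction n)
  case 0
  then show ?case by (simp add: P_0)
next
  case (Suc n)
  have "poly ([:0, 1:] * P (Suc n)) 0 = 0" by simp
  then have "poly (P (Suc (Suc n))) 0 + b (Suc n) * poly (P (Suc n)) 0 + c n * poly (P n) 0 = 0"
    unfolding recurrence[of "Suc n"] by simp
  with Suc c_pos[of n] show ?case by auto
qed

lemma moment_normal_indices:
  "Suc m \<in> normal_indices (\<lambda>j. moment (j + 1)) \<or> Suc (Suc m) \<in> normal_indices (\<lambda>j. moment (j + 1))"
  using poly_P_0_eq_0[of "Suc m"] poly_P_0_eq_0[of "Suc (Suc m)"] poly_P_0_consecutive[of "Suc m"]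
  by (auto simp: normal_indices_def)

section \<open>Cauchy transforms\<close>

text \<open>The Cauchy transform of the signed measure with density \<open>q\<close> with respect to \<open>\<sigma>\<close>.\<close>

definition cauchy :: "real poly \<Rightarrow> complex \<Rightarrow> complex" where
  "cauchy q z = (LINT t|\<sigma>. of_real (poly q t) / (of_real t - z))"

lemma of_real_minus_bound: "Im z \<le> norm (of_real t - z)"
  using abs_Im_le_cmod[of "of_real t - z"] by simp

lemma cauchy_integrand_bound:
  assumes "0 < Im z"
  shows "norm (complex_of_real (poly q t) / (of_real t - z)) \<le> \<bar>poly q t\<bar> / Im z"
proof -
  have "0 < norm (of_real t - z)" using of_real_minus_bound[of z t] assms by linarith
  then show ?thesis
    unfolding norm_divide norm_of_real
    using of_real_minus_bound[of z t] assms by (intro divide_left_mono mult_pos_pos) auto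
qed

lemma integrable_abs_poly: "integrable \<sigma> (\<lambda>t. \<bar>poly q t\<bar> / Im z)"
  by (intro integrable_divide integrable_abs integrable_poly)

lemma integrable_cauchy:
  assumes "0 < Im z"
  shows "integrable \<sigma> (\<lambda>t. complex_of_real (poly q t) / (of_real t - z))"
proof (rule Bochner_Integration.integrable_bound[OF integrable_abs_poly[of q z]])
  have "(\<lambda>t. complex_of_real (poly q t) / (of_real t - z)) \<in> borel_measurable borel"
    by (intro borel_measurable_continuous_onI continuous_intros) (use assms in \<open>auto simp: complex_eq_iff\<close>)
  then show "(\<lambda>t. complex_of_real (poly q t) / (of_real t - z)) \<in> borel_measurable \<sigma>"
    using measurable_cong_sets[OF sets refl] by blast
  show "AE t in \<sigma>. norm (complex_of_real (poly q t) / (of_real t - z)) \<le> norm (\<bar>poly q t\<bar> / Im z)"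
    using cauchy_integrand_bound[OF assms] assms by (intro AE_I2) simp
qed

lemma cauchy_add: "0 < Im z \<Longrightarrow> cauchy (p + q) z = cauchy p z + cauchy q z"
  by (simp add: cauchy_def add_divide_distrib integrable_cauchy)

lemma cauchy_0 [simp]: "cauchy 0 z = 0"
  by (simp add: cauchy_def)

lemma cauchy_smult: "cauchy (Polynomial.smult x q) z = of_real x * cauchy q z"
  unfolding cauchy_def
  by (simp only: poly_smult of_real_mult times_divide_eq_right[symmetric] mult.assoc integral_mult_right_zero)

lemma cauchy_times_var:
  assumes "0 < Im z"
  shows "cauchy ([:0, 1:] * q) z = of_real (mean q) + z * cauchy q z"
proof -
  have "complex_of_real (poly ([:0, 1:] * q) t) / (of_real t - z)
      = of_real (poly q t) + z * (of_real (poly q t) / (of_real t - z))" for t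
  proof -
    have "complex_of_real t - z \<noteq> 0" using assms by (auto simp: complex_eq_iff)
    then show ?thesis by (simp add: field_simps)
  qed
  then have "cauchy ([:0, 1:] * q) z
      = (LINT t|\<sigma>. of_real (poly q t) + z * (of_real (poly q t) / (of_real t - z)))"
    unfolding cauchy_def by presburger
  also have "\<dots> = (LINT t|\<sigma>. of_real (poly q t)) + z * cauchy q z"
    unfolding cauchy_def integral_mult_right_zero[symmetric]
    by (intro Bochner_Integration.integral_add integrable_of_real integrable_mult_right
        integrable_cauchy[OF assms] integrable_poly)
  also have "(LINT t|\<sigma>. complex_of_real (poly q t)) = of_real (mean q)"
    by (simp add: mean_def)
  finally show ?thesis .
qed

lemma cauchy_partial_expansion:
  assumes "0 < Im z"
  shows "cauchy q z + (\<Sum>k<N. of_real (mean (monom 1 k * q)) / z ^ (k + 1))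
    = cauchy (monom 1 N * q) z / z ^ N"
proof (induction N)
  case (Suc N)
  have "z \<noteq> 0" using assms by auto
  have "monom 1 (Suc N) * q = [:0, 1:] * (monom 1 N * q)"
    by (simp add: monom_Suc)
  then have "cauchy (monom 1 (Suc N) * q) z
      = of_real (mean (monom 1 N * q)) + z * cauchy (monom 1 N * q) z"
    using cauchy_times_var[OF assms] by simp
  then have "cauchy (monom 1 (Suc N) * q) z / z ^ Suc N
      = cauchy (monom 1 N * q) z / z ^ N + of_real (mean (monom 1 N * q)) / z ^ (N + 1)"
    using \<open>z \<noteq> 0\<close> by (simp add: add_divide_distrib)
  then show ?case using Suc by (simp add: add.assoc[symmetric])
qed simp

lemma cauchy_bound:
  assumes "0 < Im z"
  shows "norm (cauchy q z) \<le> (LINT t|\<sigma>. \<bar>poly q t\<bar>) / Im z"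
proof -
  have "norm (cauchy q z) \<le> (LINT t|\<sigma>. \<bar>poly q t\<bar> / Im z)"
    unfolding cauchy_def
    by (rule Bochner_Integration.integral_norm_bound_integral[OF integrable_cauchy[OF assms] integrable_abs_poly])
      (rule cauchy_integrand_bound[OF assms])
  then show ?thesis by simp
qed

text \<open>
  The remainder after \<open>N\<close> terms is a Cauchy transform divided by \<open>z ^ N\<close>, and Cauchy transforms are
  \<open>O(1 / z)\<close> in a sector because \<open>Im z \<ge> sin \<epsilon> * norm z\<close> there.
\<close>

lemma cauchy_expands: "expands (cauchy q) (moment_fps (\<lambda>k. mean (monom 1 k * q)))"
  unfolding expands_def
proof (intro allI impI)
  fix \<epsilon> :: real and N assume "0 < \<epsilon>"
  let ?a = "moment_fps (\<lambda>k. mean (monom 1 k * q))"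
  let ?R = "\<lambda>N z. cauchy q z - (\<Sum>j<N. of_real (fps_nth ?a j) / z ^ j)"
  have *: "?R (Suc N) \<in> O[sector_at_infinity \<epsilon>](\<lambda>z. 1 / z ^ Suc N)" for N
  proof (rule bigoI)
    let ?K = "(LINT t|\<sigma>. \<bar>poly (monom 1 N * q) t\<bar>)"
    show "\<forall>\<^sub>F z in sector_at_infinity \<epsilon>. norm (?R (Suc N) z) \<le> ?K / sin \<epsilon> * norm (1 / z ^ Suc N)"
    proof (rule eventually_sectorI[where R = 1])
      fix z assume z: "1 \<le> norm z" "\<epsilon> < Arg z" "Arg z < pi - \<epsilon>"
      have sin: "0 < sin \<epsilon>" using sin_pos_in_sector[OF \<open>0 < \<epsilon>\<close> z(2,3)] .
      have low: "norm z * sin \<epsilon> \<le> Im z" using Im_lower_bound_in_sector[OF \<open>0 < \<epsilon>\<close> z(2,3)] .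
      have pos: "0 < norm z * sin \<epsilon>" using sin z(1) by (intro mult_pos_pos) auto
      then have Im: "0 < Im z" using low by simp
      have "norm (cauchy (monom 1 N * q) z) \<le> ?K / Im z"
        by (rule cauchy_bound[OF Im])
      also have "\<dots> \<le> ?K / (norm z * sin \<epsilon>)"
        using low pos by (intro divide_left_mono) (auto intro!: mult_pos_pos Im)
      finally have "norm (cauchy (monom 1 N * q) z) / norm z ^ N \<le> ?K / (norm z * sin \<epsilon>) / norm z ^ N"
        by (intro divide_right_mono) auto
      moreover have "?R (Suc N) z = cauchy (monom 1 N * q) z / z ^ N"
        unfolding moment_fps_sum using cauchy_partial_expansion[OF Im, of q N] by simp
      ultimately show "norm (?R (Suc N) z) \<le> ?K / sin \<epsilon> * norm (1 / z ^ Suc N)"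
        by (simp add: norm_divide norm_power norm_mult field_simps)
    qed
  qed
  show "?R N \<in> O[sector_at_infinity \<epsilon>](\<lambda>z. 1 / z ^ N)"
  proof (cases N)
    case 0
    from landau_o.big_trans[OF *[of 0] sector_power_bigo[of 0 "Suc 0"]] show ?thesis
      by (simp add: 0)
  next
    case (Suc M)
    show ?thesis unfolding Suc by (rule *)
  qed
qed

end

section \<open>The Darboux transformation\<close>

lemma open_upper_half_plane: "open upper_half_plane"
  unfolding upper_half_plane_def by (rule open_halfspace_Im_gt)

lemma connected_upper_half_plane: "connected upper_half_plane"
  unfolding upper_half_plane_def by (intro convex_connected convex_halfspace_Im_gt)

lemma first_coefficientI:
  assumes "\<And>i. i < m \<Longrightarrow> s i = 0" "s m \<noteq> 0"
  shows "first_coefficient s = s m"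
proof -
  have "(LEAST j. s j \<noteq> 0) = m"
    using assms by (intro Least_equality) (auto simp: not_less[symmetric])
  then show ?thesis by (simp add: first_coefficient_def)
qed

text \<open>
  The partition into blocks is arbitrary here; that it comes from the normal indices matters only when
  the result is compared with the definition of the generalized Jacobi matrix.
\<close>

locale Darboux_transformation =
  orthogonal_polynomials \<sigma> P b c + block_partition n k
  for \<sigma> P b c n k +
  fixes F :: "complex \<Rightarrow> complex" and l u\<^sub>0 u\<^sub>1 :: "nat \<Rightarrow> real"
  assumes F_holomorphic: "F holomorphic_on upper_half_plane"
    and F_cauchy: "z \<in> upper_half_plane \<Longrightarrow> F z = cauchy 1 z"
    and J_eq_LU: "monic_Jacobi_matrix b c = inf_matrix_mult (L_matrix l) (U_matrix u\<^sub>0 u\<^sub>1)"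
begin

text \<open>
  The functions of the second kind. On the upper half-plane \<open>Q m\<close> is the Cauchy transform of \<open>P m\<close>;
  the recurrence, whose inhomogeneous term \<open>moment 0\<close> appears at \<open>m = 0\<close>, defines it everywhere and
  makes holomorphy immediate.
\<close>

fun Q :: "nat \<Rightarrow> complex \<Rightarrow> complex" where
  "Q 0 z = F z"
| "Q (Suc 0) z = (z - of_real (b 0)) * F z + of_real (moment 0)"
| "Q (Suc (Suc m)) z = (z - of_real (b (Suc m))) * Q (Suc m) z - of_real (c m) * Q m z"

lemma mean_P: "0 < j \<Longrightarrow> mean (P j) = 0"
  using mean_mult_P_less[of 1 j] by simp

lemma Q_eq_cauchy:
  assumes "z \<in> upper_half_plane"
  shows "Q m z = cauchy (P m) z"
proof -
  have Im: "0 < Im z" using assms by (simp add: upper_half_plane_def)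
  have rec: "of_real (mean (P j)) + z * cauchy (P j) z = cauchy (P (Suc j)) z + of_real (b j) * cauchy (P j) z
      + (if j = 0 then 0 else of_real (c (j - 1)) * cauchy (P (j - 1)) z)" for j
  proof -
    have "of_real (mean (P j)) + z * cauchy (P j) z = cauchy ([:0, 1:] * P j) z"
      by (simp only: cauchy_times_var[OF Im])
    then show ?thesis
      unfolding recurrence[of j] by (simp add: cauchy_add[OF Im] cauchy_smult)
  qed
  show ?thesis
  proof (induction m rule: induct_nat_012)
    case 0
    then show ?case by (simp add: F_cauchy[OF assms] P_0)
  next
    case 1
    then show ?case
      using rec[of 0] by (simp add: F_cauchy[OF assms] P_0 moment_def algebra_simps)
  next
    case (ge2 m)
    then show ?case
      using rec[of "Suc m"] by (simp add: mean_P algebra_simps)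
  qed
qed

lemma Q_holomorphic: "Q m holomorphic_on upper_half_plane"
proof (induction m rule: induct_nat_012)
  case 0
  then show ?case using F_holomorphic by simp
next
  case 1
  have "(\<lambda>z. (z - of_real (b 0)) * F z + of_real (moment 0)) holomorphic_on upper_half_plane"
    by (intro holomorphic_intros F_holomorphic)
  then show ?case by simp
next
  case (ge2 m)
  have "(\<lambda>z. (z - of_real (b (Suc m))) * Q (Suc m) z - of_real (c m) * Q m z) holomorphic_on upper_half_plane"
    by (intro holomorphic_intros ge2)
  then show ?case by simp
qed

text \<open>Orthogonality makes the first \<open>m\<close> moments of \<open>P m\<close> vanish.\<close>

lemma Q_expands:
  obtains a where "expands (Q m) a" "\<forall>i\<le>m. fps_nth a i = 0" "fps_nth a (Suc m) = - h m"
proof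
  let ?a = "moment_fps (\<lambda>k. mean (monom 1 k * P m))"
  show "expands (Q m) ?a"
  proof (rule expands_cong[OF cauchy_expands])
    fix \<epsilon> :: real assume "0 < \<epsilon>"
    from eventually_sector_upper_half_plane[OF this]
    show "\<forall>\<^sub>F z in sector_at_infinity \<epsilon>. cauchy (P m) z = Q m z"
      by eventually_elim (simp add: Q_eq_cauchy)
  qed
  show "\<forall>i\<le>m. fps_nth ?a i = 0"
  proof (intro allI impI)
    fix i assume "i \<le> m"
    then show "fps_nth ?a i = 0"
      by (cases i) (auto intro!: mean_mult_P_less simp: degree_monom_eq)
  qed
  show "fps_nth ?a (Suc m) = - h m"
    using mean_mult_P[of "monom 1 m" m] by (simp add: degree_monom_eq)
qed

text \<open>
  The function \<open>r j\<close> is the component of \<open>U Q\<close> in the first row of block \<open>j\<close>. The function \<open>w j\<close> is the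
  multiple of \<open>r (j - 1)\<close> that \<open>L\<close> adds to it; its value at \<open>j = 0\<close> makes \<open>r j + w j = z * Q (n j)\<close>
  hold there as well. The polynomial \<open>p j\<close> is read off from the diagonal block \<open>j\<close> of \<open>U L\<close>.
\<close>

definition r :: "nat \<Rightarrow> complex \<Rightarrow> complex" where
  "r j z = of_real (if k j = 1 then u\<^sub>0 j else 0) * Q (n j) z + Q (Suc (n j)) z"

definition w :: "nat \<Rightarrow> complex \<Rightarrow> complex" where
  "w j z = (case j of 0 \<Rightarrow> - of_real (moment 0) | Suc i \<Rightarrow> of_real (l (Suc i)) * r i z)"

definition p :: "nat \<Rightarrow> real poly" where
  "p j = (if k j = 1 then [:- (u\<^sub>0 j + l (Suc j)), 1:] else [:- (u\<^sub>0 j + l (Suc j)), - u\<^sub>1 j, 1:])"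

lemmas entries = LU_entries[OF J_eq_LU]

text \<open>This product is \<open>c (n j)\<close> or \<open>c (n j) * c (n j + 1)\<close>, according to the size of the block.\<close>

lemma u_l_pos: "0 < u\<^sub>0 j * l (Suc j)"
  using k_cases[of j] entries(1-3)[of j] c_pos[of "n j"] c_pos[of "Suc (n j)"]
  by (auto simp: mult.commute)

lemma u_nonzero: "u\<^sub>0 j \<noteq> 0" and l_nonzero: "l (Suc j) \<noteq> 0"
  using u_l_pos[of j] by auto

lemma h_n_Suc: "h (n (Suc j)) = u\<^sub>0 j * l (Suc j) * h (n j)"
  using k_cases[of j] entries(1-3)[of j] by (auto simp: n_Suc h_Suc)

lemma r_0: "r 0 z = z * F z + of_real (moment 0)"
  using entries(5) by (auto simp: r_def n_0 algebra_simps)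

lemma Q_Suc_n:
  "Q (Suc (n (Suc j))) z = (z - of_real (b (n (Suc j)))) * Q (n (Suc j)) z
     - of_real (c (n (Suc j) - 1)) * Q (n (Suc j) - 1) z"
proof -
  obtain m where "n (Suc j) = Suc m" using k_pos[of j] n_Suc[of j] not0_implies_Suc[of "n (Suc j)"] by auto
  then show ?thesis by simp
qed

lemma r_plus_w: "r j z + w j z = z * Q (n j) z"
proof (cases j)
  case 0
  then show ?thesis by (simp add: r_0 w_def n_0)
next
  case (Suc i)
  show ?thesis
    using k_cases[of i]
  proof
    assume k: "k i = 1"
    then have "n (Suc i) - 1 = n i" and n: "Suc (n i) = n (Suc i)" by (simp_all add: n_Suc)
    then show ?thesis
      unfolding Suc w_def r_def Q_Suc_n entries(6)
      using k entries(1)[OF k] by (simp add: n algebra_simps)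
  next
    assume k: "k i = 2"
    then have "n (Suc i) - 1 = Suc (n i)" by (simp add: n_Suc)
    then show ?thesis
      unfolding Suc w_def r_def Q_Suc_n entries(6)
      using k entries(3)[OF k] by (simp add: algebra_simps)
  qed
qed

text \<open>The three-term recurrence encoded by the rows of \<open>U L\<close>.\<close>

lemma r_Suc: "r (Suc j) z = poly (map_poly of_real (p j)) z * r j z - of_real (u\<^sub>0 j) * w j z"
  using k_cases[of j]
proof
  assume k: "k j = 1"
  have 1: "r (Suc j) z = z * Q (Suc (n j)) z - of_real (l (Suc j)) * r j z"
    using r_plus_w[of "Suc j" z] k by (simp add: w_def n_Suc algebra_simps)
  have 2: "w j z = z * Q (n j) z - r j z"
    using r_plus_w[of j z] by (simp add: algebra_simps)
  have 3: "Q (Suc (n j)) z = r j z - of_real (u\<^sub>0 j) * Q (n j) z"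
    using k by (simp add: r_def)
  show ?thesis
    unfolding 1 2 3 using k by (simp add: p_def map_poly_pCons algebra_simps)
next
  assume k: "k j = 2"
  have 1: "r (Suc j) z = z * Q (Suc (Suc (n j))) z - of_real (l (Suc j)) * r j z"
    using r_plus_w[of "Suc j" z] k by (simp add: w_def n_Suc algebra_simps)
  have 2: "w j z = z * Q (n j) z - r j z"
    using r_plus_w[of j z] by (simp add: algebra_simps)
  have 3: "Q (Suc (n j)) z = r j z"
    using k by (simp add: r_def)
  have 4: "Q (Suc (Suc (n j))) z = (z - of_real (u\<^sub>1 j)) * r j z - of_real (u\<^sub>0 j) * Q (n j) z"
    using entries(2,4)[OF k] by (simp add: 3)
  show ?thesis
    unfolding 1 2 4 using k by (simp add: p_def map_poly_pCons algebra_simps)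
qed

lemma r_expands:
  obtains a where "expands (r j) a" "\<forall>i<n (Suc j). fps_nth a i = 0"
    "fps_nth a (n (Suc j)) = - u\<^sub>0 j * h (n j)"
proof -
  let ?x = "if k j = 1 then u\<^sub>0 j else 0"
  obtain a where a: "expands (Q (n j)) a" "\<forall>i\<le>n j. fps_nth a i = 0" "fps_nth a (Suc (n j)) = - h (n j)"
    by (rule Q_expands)
  obtain a' where a': "expands (Q (Suc (n j))) a'" "\<forall>i\<le>Suc (n j). fps_nth a' i = 0"
      "fps_nth a' (Suc (Suc (n j))) = - h (Suc (n j))"
    by (rule Q_expands)
  have "expands (r j) (fps_const ?x * a + a')"
    unfolding r_def[abs_def] by (intro expands_add expands_cmult a a')
  then show ?thesis
    using k_cases[of j] entries(2)[of j] a a'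
    by (intro that[of "fps_const ?x * a + a'"]) (auto simp: n_Suc h_Suc less_Suc_eq_le)
qed

lemma w_expands:
  obtains a where "expands (w j) a" "\<forall>i<n j. fps_nth a i = 0" "fps_nth a (n j) = - h (n j)"
proof (cases j)
  case 0
  have "expands (w 0) (fps_const (- moment 0))"
    using expands_const[of "- moment 0"] by (simp add: w_def[abs_def])
  then show ?thesis using that by (simp add: 0 n_0 h_0)
next
  case (Suc i)
  obtain a where a: "expands (r i) a" "\<forall>m<n (Suc i). fps_nth a m = 0"
      "fps_nth a (n (Suc i)) = - u\<^sub>0 i * h (n i)"
    by (rule r_expands)
  have "expands (w j) (fps_const (l (Suc i)) * a)"
    unfolding w_def[abs_def] Suc using expands_cmult[OF a(1)] by simp
  then show ?thesis using a
    by (intro that[of "fps_const (l (Suc i)) * a"]) (auto simp: Suc h_n_Suc)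
qed

lemma r_holomorphic: "r j holomorphic_on upper_half_plane"
  unfolding r_def[abs_def] by (intro holomorphic_intros Q_holomorphic)

lemma w_holomorphic: "w j holomorphic_on upper_half_plane"
  unfolding w_def[abs_def] by (cases j) (auto intro!: holomorphic_intros r_holomorphic)

lemma r_eventually_nonzero:
  assumes "0 < \<epsilon>"
  shows "\<forall>\<^sub>F z in sector_at_infinity \<epsilon>. r j z \<noteq> 0"
proof -
  obtain a where a: "expands (r j) a" "\<forall>i<n (Suc j). fps_nth a i = 0"
      "fps_nth a (n (Suc j)) = - u\<^sub>0 j * h (n j)"
    by (rule r_expands[of j])
  have "fps_nth a (n (Suc j)) \<noteq> 0" using a(3) u_nonzero[of j] h_pos[of "n j"] by simp
  from expands_eventually_nonzero[OF a(1,2) this assms] show ?thesis .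
qed

lemma r_cosparse_nonzero: "\<forall>\<^sub>\<approx>z\<in>upper_half_plane. r j z \<noteq> 0"
proof -
  have "\<forall>\<^sub>F z in sector_at_infinity 1. z \<in> upper_half_plane \<and> r j z \<noteq> 0"
    by (intro eventually_conj eventually_sector_upper_half_plane r_eventually_nonzero) auto
  then obtain z\<^sub>0 where "z\<^sub>0 \<in> upper_half_plane" "r j z\<^sub>0 \<noteq> 0"
    using eventually_happens'[OF sector_at_infinity_neq_bot] by blast
  then have "\<forall>\<^sub>F z in at \<zeta>. r j z \<noteq> 0 \<and> z \<in> upper_half_plane" if "\<zeta> \<in> upper_half_plane" for \<zeta>
    using that by (intro non_zero_neighbour_alt[OF r_holomorphic open_upper_half_plane
          connected_upper_half_plane])
  then have "\<forall>\<^sub>F z in at \<zeta>. r j z \<noteq> 0" if "\<zeta> \<in> upper_half_plane" for \<zeta>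
    using that by (simp add: eventually_conj_iff)
  then show ?thesis by (simp add: eventually_cosparse_open_eq[OF open_upper_half_plane])
qed

text \<open>
  The functions, signs and constants of the recursion: dividing \<open>r_Suc\<close> by \<open>r j\<close> turns the
  three-term recurrence into a continued fraction for \<open>- r j / (u\<^sub>0 j * w j)\<close>, and multiplying by
  \<open>sgn (u\<^sub>0 j)\<close> normalizes its signs. Since \<open>u\<^sub>0 j * l (Suc j) > 0\<close>, the sign of \<open>l (Suc j)\<close> is \<open>e j\<close> too.
\<close>

definition G :: "nat \<Rightarrow> complex \<Rightarrow> complex" where
  "G j z = - (r j z / (of_real \<bar>u\<^sub>0 j\<bar> * w j z))"

definition e :: "nat \<Rightarrow> real" where
  "e j = sgn (u\<^sub>0 j)"

definition \<beta> :: "nat \<Rightarrow> real" where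
  "\<beta> j = sqrt \<bar>u\<^sub>0 (Suc j) * l (Suc j)\<bar>"

lemma G_meromorphic: "G j meromorphic_on upper_half_plane"
  unfolding G_def[abs_def]
  by (intro meromorphic_intros analytic_on_imp_meromorphic_on)
    (auto simp: analytic_on_open[OF open_upper_half_plane] intro: r_holomorphic w_holomorphic)

text \<open>
  Both \<open>r j\<close> and \<open>w j\<close> have known leading terms, of orders \<open>n j + k j\<close> and \<open>n j\<close> in \<open>1 / z\<close>; their
  quotient starts with \<open>u\<^sub>0 j / z ^ k j\<close>.
\<close>

lemma G_expands:
  obtains t where "asymptotic_expansion (G j) t" "\<And>i. i < k j - 1 \<Longrightarrow> t i = 0" "t (k j - 1) = e j"
proof -
  obtain a where a: "expands (r j) a" "\<forall>i<n j + k j. fps_nth a i = 0"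
      "fps_nth a (n j + k j) = - u\<^sub>0 j * h (n j)"
    using r_expands[of j] by (metis n_Suc)
  obtain d where d: "expands (w j) d" "\<forall>i<n j. fps_nth d i = 0" "fps_nth d (n j) = - h (n j)"
    by (rule w_expands)
  have h: "h (n j) \<noteq> 0" using h_pos[of "n j"] by simp
  obtain q where q: "expands (\<lambda>z. r j z / w j z) q" "\<forall>i<k j. fps_nth q i = 0" "fps_nth q (k j) = u\<^sub>0 j"
    using expands_divide_shifted[OF a(1,2) d(1,2)] a(3) d(3) h by auto
  define x where "x = - 1 / \<bar>u\<^sub>0 j\<bar>"
  define t where "t i = - x * fps_nth q (Suc i)" for i
  have "expands (G j) (fps_const x * q)"
    using expands_cmult[OF q(1), of x] by (simp add: G_def[abs_def] x_def)
  moreover have "fps_const x * q = moment_fps t"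
  proof (rule fps_ext)
    fix i show "fps_nth (fps_const x * q) i = fps_nth (moment_fps t) i"
      using q(2) k_pos[of j] by (cases i) (auto simp: t_def)
  qed
  ultimately have "asymptotic_expansion (G j) t"
    by (simp add: asymptotic_expansion_iff_expands)
  moreover have "t i = 0" if "i < k j - 1" for i
    using q(2) that by (simp add: t_def)
  moreover have "t (k j - 1) = e j"
    using q(3) k_pos[of j] u_nonzero[of j] by (simp add: t_def x_def e_def sgn_real_def)
  ultimately show ?thesis by (rule that)
qed

lemma G_recursion:
  assumes "r j z \<noteq> 0"
  shows "- 1 / G j z = of_real (e j) * poly (map_poly of_real (p j)) z + of_real ((\<beta> j)\<^sup>2) * G (Suc j) z"
proof -
  let ?u = "complex_of_real (u\<^sub>0 j)" and ?l = "complex_of_real (l (Suc j))"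
  have eu: "\<bar>u\<^sub>0 j\<bar> = e j * u\<^sub>0 j" by (simp add: e_def abs_sgn mult.commute)
  have el: "\<bar>l (Suc j)\<bar> = e j * l (Suc j)"
    using u_l_pos[of j] by (auto simp: e_def sgn_real_def zero_less_mult_iff)
  have "(\<beta> j)\<^sup>2 = \<bar>u\<^sub>0 (Suc j)\<bar> * \<bar>l (Suc j)\<bar>"
    by (simp add: \<beta>_def abs_mult)
  then have b2: "(\<beta> j)\<^sup>2 = \<bar>u\<^sub>0 (Suc j)\<bar> * (e j * l (Suc j))" by (simp only: el)
  have "of_real ((\<beta> j)\<^sup>2) * G (Suc j) z = - (of_real (e j) * r (Suc j) z / r j z)"
    using u_nonzero[of "Suc j"] l_nonzero[of j] assms
    by (simp add: b2 G_def w_def)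
  also have "\<dots> = - (of_real (e j) * poly (map_poly of_real (p j)) z) + of_real (e j) * ?u * w j z / r j z"
    using assms by (simp add: r_Suc field_simps)
  also have "of_real (e j) * ?u * w j z / r j z = - 1 / G j z"
    by (simp add: G_def eu)
  finally show ?thesis by simp
qed

lemma \<beta>_pos: "0 < \<beta> j"
  using u_nonzero[of "Suc j"] l_nonzero[of j] by (simp add: \<beta>_def)

lemma G_remainder:
  assumes "0 < \<epsilon>"
  shows "(\<lambda>z. - 1 / G j z - of_real (e j) * poly (map_poly of_real (p j)) z) \<in> o[sector_at_infinity \<epsilon>](\<lambda>_. 1)"
proof -
  obtain t where "asymptotic_expansion (G (Suc j)) t" by (rule G_expands[of "Suc j"])
  then have "(G (Suc j) \<longlongrightarrow> 0) (sector_at_infinity \<epsilon>)"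
    using expands_tendsto[OF _ assms, of "G (Suc j)" "moment_fps t"]
    by (simp add: asymptotic_expansion_iff_expands)
  then have "((\<lambda>z. of_real ((\<beta> j)\<^sup>2) * G (Suc j) z) \<longlongrightarrow> 0) (sector_at_infinity \<epsilon>)"
    by (rule tendsto_mult_right_zero)
  moreover have "\<forall>\<^sub>F z in sector_at_infinity \<epsilon>. of_real ((\<beta> j)\<^sup>2) * G (Suc j) z
      = - 1 / G j z - of_real (e j) * poly (map_poly of_real (p j)) z"
    using r_eventually_nonzero[OF assms, of j]
  proof eventually_elim
    case (elim z)
    show ?case unfolding G_recursion[OF elim] by simp
  qed
  ultimately have "((\<lambda>z. - 1 / G j z - of_real (e j) * poly (map_poly of_real (p j)) z) \<longlongrightarrow> 0)
      (sector_at_infinity \<epsilon>)"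
    by (rule Lim_transform_eventually)
  then show ?thesis by (intro smalloI_tendsto) simp_all
qed

lemma e_\<beta>: "e j * e (Suc j) * (\<beta> j)\<^sup>2 = u\<^sub>0 (Suc j) * l (Suc j)"
  using u_l_pos[of j] by (auto simp: e_def \<beta>_def sgn_real_def abs_mult zero_less_mult_iff)

lemma e_cases: "e j = 1 \<or> e j = -1"
  using u_nonzero[of j] by (auto simp: e_def sgn_real_def)

lemma degree_p: "degree (p j) = k j" and lead_coeff_p: "lead_coeff (p j) = 1"
  using k_cases[of j] by (auto simp: p_def)

text \<open>For \<open>k j = 1\<close> the last argument of \<open>diagonal_block\<close> is ignored.\<close>

lemma UL_eq:
  "inf_matrix_mult (U_matrix u\<^sub>0 u\<^sub>1) (L_matrix l) =
     block_tridiagonal n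
       (\<lambda>j. lower_left_block (k (Suc j)) (e j * e (Suc j) * (\<beta> j)\<^sup>2))
       (\<lambda>j. diagonal_block (k j) (- coeff (p j) 0) (- coeff (p j) 1))
       (\<lambda>j. lower_left_block (k j) 1)"
proof -
  have "diagonal_block (k j) (u\<^sub>0 j + l (Suc j)) (u\<^sub>1 j)
      = diagonal_block (k j) (- coeff (p j) 0) (- coeff (p j) 1)" for j
    by (auto simp: diagonal_block_def p_def fun_eq_iff)
  then show ?thesis by (simp add: UL_matrix e_\<beta>)
qed

lemma generalized_Jacobi_matrix_of_Darboux:
  assumes "n = normal_index (\<lambda>j. moment (j + 1))" "k = normal_gap (\<lambda>j. moment (j + 1))"
    and D: "(\<lambda>z. z * F z + of_real (moment 0)) \<in> D_minus"
    and nonrational: "\<not> rational_function (\<lambda>z. z * F z + of_real (moment 0))"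
    and expansion: "asymptotic_expansion (\<lambda>z. z * F z + of_real (moment 0)) (\<lambda>j. moment (j + 1))"
  shows "generalized_Jacobi_matrix_of (\<lambda>z. z * F z + of_real (moment 0))
    (inf_matrix_mult (U_matrix u\<^sub>0 u\<^sub>1) (L_matrix l))"
proof -
  let ?s = "\<lambda>j. moment (j + 1)"
  have "\<exists>t. asymptotic_expansion (G j) t \<and> e j = first_coefficient t" for j
  proof -
    obtain t where t: "asymptotic_expansion (G j) t" "\<And>i. i < k j - 1 \<Longrightarrow> t i = 0" "t (k j - 1) = e j"
      by (rule G_expands[of j]) auto
    have "t (k j - 1) \<noteq> 0" using t(3) e_cases[of j] by auto
    with t show ?thesis using first_coefficientI[of "k j - 1" t] by auto
  qed
  then obtain t where t: "\<And>j. asymptotic_expansion (G j) (t j)" "\<And>j. e j = first_coefficient (t j)"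
    by metis
  have "first_coefficient ?s = u\<^sub>0 0 * moment 0"
  proof -
    obtain a where a: "expands (r 0) a" "\<forall>i<n (Suc 0). fps_nth a i = 0"
        "fps_nth a (n (Suc 0)) = - u\<^sub>0 0 * h (n 0)"
      by (rule r_expands[of 0])
    have "expands (r 0) (moment_fps ?s)"
      using expansion by (simp add: asymptotic_expansion_iff_expands r_0[abs_def])
    then have "a = moment_fps ?s" using a(1) expands_unique by blast
    then have s: "?s i = - fps_nth a (Suc i)" for i by simp
    have k: "Suc (k 0 - 1) = n (Suc 0)" using k_pos[of 0] by (simp add: n_Suc n_0)
    have "?s (k 0 - 1) = u\<^sub>0 0 * moment 0"
      unfolding s k using a(3) by (simp add: n_0 h_0)
    moreover have "?s i = 0" if "i < k 0 - 1" for i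
      unfolding s using a(2) that k by simp
    ultimately show ?thesis
      using first_coefficientI[of "k 0 - 1" ?s] u_nonzero[of 0] moment_0_pos by simp
  qed
  then have G_0: "G 0 = (\<lambda>z. (z * F z + of_real (moment 0)) / of_real \<bar>first_coefficient ?s\<bar>)"
    using moment_0_pos by (intro ext) (simp add: G_def r_0 w_def abs_mult)
  have "\<forall>\<^sub>\<approx>z\<in>upper_half_plane. - 1 / G j z
      = of_real (e j) * poly (map_poly of_real (p j)) z + of_real ((\<beta> j)\<^sup>2) * G (Suc j) z" for j
    using r_cosparse_nonzero[of j] by eventually_elim (rule G_recursion)
  then have step: "\<forall>j. G j meromorphic_on upper_half_plane \<and>
      asymptotic_expansion (G j) (t j) \<and>
      e j = first_coefficient (t j) \<and> (e j = 1 \<or> e j = -1) \<and>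
      degree (p j) = k j \<and> lead_coeff (p j) = 1 \<and>
      (\<forall>\<epsilon>>0. (\<lambda>z. - 1 / G j z - of_real (e j) * poly (map_poly of_real (p j)) z)
          \<in> o[sector_at_infinity \<epsilon>](\<lambda>_. 1)) \<and>
      \<beta> j > 0 \<and>
      (\<forall>\<^sub>\<approx>z\<in>upper_half_plane. - 1 / G j z
          = of_real (e j) * poly (map_poly of_real (p j)) z + of_real ((\<beta> j)\<^sup>2) * G (Suc j) z)"
    by (intro allI conjI impI G_meromorphic t e_cases degree_p lead_coeff_p G_remainder \<beta>_pos)
  show ?thesis
    unfolding generalized_Jacobi_matrix_of_def Let_def
    by (intro conjI UnI1 D nonrational, rule exI[of _ ?s], fold assms(1,2),
        rule exI[of _ G], rule exI[of _ t], rule exI[of _ e], rule exI[of _ p], rule exI[of _ \<beta>],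
        intro conjI expansion G_0 step UL_eq)
qed

end

section \<open>The transformed function\<close>

lemma rational_function_shift:
  assumes "rational_function (\<lambda>z. z * F z + of_real x)"
  shows "rational_function F"
proof -
  obtain p q where pq: "q \<noteq> 0" "\<forall>\<^sub>\<approx>z\<in>upper_half_plane. z * F z + of_real x = poly p z / poly q z"
    using assms unfolding rational_function_def by blast
  have "finite {z. poly q z = 0}" using poly_roots_finite[OF pq(1)] .
  then have "\<forall>\<^sub>\<approx>z\<in>upper_half_plane. poly q z \<noteq> 0"
    by (simp add: eventually_cosparse finite_imp_sparse)
  moreover have "\<forall>\<^sub>\<approx>z\<in>upper_half_plane. z \<in> upper_half_plane"
    by (rule eventually_in_cosparse[OF order_refl open_upper_half_plane])
  ultimately have "\<forall>\<^sub>\<approx>z\<in>upper_half_plane.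
      F z = poly (p - Polynomial.smult (of_real x) q) z / poly ([:0, 1:] * q) z"
    using pq(2)
  proof eventually_elim
    case (elim z)
    then have "z \<noteq> 0" by (auto simp: upper_half_plane_def)
    have "z * F z = (poly p z - of_real x * poly q z) / poly q z"
      using elim by (simp add: field_simps)
    then show ?case using elim \<open>z \<noteq> 0\<close> by (simp add: field_simps)
  qed
  moreover have "[:0, 1:] * q \<noteq> 0" using pq(1) by simp
  ultimately show ?thesis unfolding rational_function_def by blast
qed

lemma asymptotic_expansion_shift:
  assumes "asymptotic_expansion F s"
  shows "asymptotic_expansion (\<lambda>z. z * F z + of_real (s 0)) (\<lambda>j. s (j + 1))"
proof -
  have "expands (\<lambda>z. z * F z + of_real (s 0)) (fps_shift 1 (moment_fps s) + fps_const (s 0))"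
    using assms by (intro expands_add expands_times expands_const) (simp_all add: asymptotic_expansion_iff_expands)
  moreover have "fps_shift 1 (moment_fps s) + fps_const (s 0) = moment_fps (\<lambda>j. s (j + 1))"
  proof (rule fps_ext)
    fix i show "fps_nth (fps_shift 1 (moment_fps s) + fps_const (s 0)) i = fps_nth (moment_fps (\<lambda>j. s (j + 1))) i"
      by (cases i) auto
  qed
  ultimately show ?thesis by (simp add: asymptotic_expansion_iff_expands)
qed

lemma Nevanlinna_minf_cong:
  assumes "F \<in> Nevanlinna_minf" "\<And>z. z \<in> upper_half_plane \<Longrightarrow> F z = G z"
  shows "G \<in> Nevanlinna_minf"
proof -
  obtain s where s: "asymptotic_expansion F s" and F: "F \<in> Nevanlinna"
    using assms(1) by (auto simp: Nevanlinna_minf_def)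
  have "expands G (moment_fps s)"
  proof (rule expands_cong)
    show "expands F (moment_fps s)" using s by (simp add: asymptotic_expansion_iff_expands)
    fix \<epsilon> :: real assume "0 < \<epsilon>"
    from eventually_sector_upper_half_plane[OF this]
    show "\<forall>\<^sub>F z in sector_at_infinity \<epsilon>. F z = G z" by eventually_elim (rule assms(2))
  qed
  moreover have "G \<in> Nevanlinna"
    using F assms(2) holomorphic_cong[OF refl, of upper_half_plane F G]
    by (auto simp: Nevanlinna_def)
  ultimately show ?thesis by (auto simp: Nevanlinna_minf_def asymptotic_expansion_iff_expands)
qed

lemma D_minus_shift:
  assumes "F \<in> Nevanlinna_minf" "x \<noteq> 0"
  shows "(\<lambda>z. z * F z + of_real x) \<in> D_minus"
proof -
  have "F holomorphic_on upper_half_plane"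
    using assms(1) by (simp add: Nevanlinna_minf_def Nevanlinna_def)
  then have "(\<lambda>z. z * F z + of_real x) analytic_on upper_half_plane"
    by (simp add: analytic_on_open[OF open_upper_half_plane] holomorphic_intros)
  moreover have "(\<lambda>z. - (of_real x / z) + (z * F z + of_real x) / z) \<in> Nevanlinna_minf"
    using assms(1) by (rule Nevanlinna_minf_cong) (auto simp: upper_half_plane_def add_divide_distrib)
  ultimately show ?thesis
    using assms(2) by (auto simp: D_minus_def intro: analytic_on_imp_meromorphic_on)
qed

theorem theorem3p2:
  fixes F :: "complex \<Rightarrow> complex" and s :: "nat \<Rightarrow> real" and J L U :: inf_matrix
  assumes "F \<in> Nevanlinna_minf" and "\<not> rational_function F"
    and "asymptotic_expansion F s"
    and "monic_Jacobi_matrix_of F J"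
    and "block_LU_factorization s J L U"
  shows "(\<lambda>z. z * F z + of_real (s 0)) \<in> D_minus \<and>
    generalized_Jacobi_matrix_of (\<lambda>z. z * F z + of_real (s 0)) (inf_matrix_mult U L)"
proof -
  obtain \<sigma> :: "real measure" and P :: "nat \<Rightarrow> real poly" and b c where
    finite: "finite_measure \<sigma>" and sets: "sets \<sigma> = sets borel"
    and power: "\<forall>j. integrable \<sigma> (\<lambda>t. t ^ j)"
    and F: "\<forall>z\<in>upper_half_plane. F z = (LINT t|\<sigma>. 1 / (complex_of_real t - z))"
    and P: "\<forall>j. degree (P j) = j \<and> lead_coeff (P j) = 1"
    and orth: "\<forall>i j. i \<noteq> j \<longrightarrow> (LINT t|\<sigma>. poly (P i) t * poly (P j) t) = 0"
    and rec: "\<forall>j. [:0, 1:] * P j = P (Suc j) + Polynomial.smult (b j) (P j)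
                + (if j = 0 then 0 else Polynomial.smult (c (j - 1)) (P (j - 1)))"
    and c: "\<forall>j. c j > 0" and J: "J = monic_Jacobi_matrix b c"
    using assms(4) unfolding monic_Jacobi_matrix_of_def by (elim exE conjE) (rule that; assumption)
  have F_Nevanlinna: "F holomorphic_on upper_half_plane" "F ` upper_half_plane \<subseteq> upper_half_plane"
    using assms(1) by (simp_all add: Nevanlinna_minf_def Nevanlinna_def)
  \<comment> \<open>A measure of mass zero would give \<open>F \<i> = 0\<close>, which is not in the upper half-plane.\<close>
  have nonnull: "measure \<sigma> (space \<sigma>) \<noteq> 0"
  proof
    assume "measure \<sigma> (space \<sigma>) = 0"
    then have "emeasure \<sigma> (space \<sigma>) = 0"
      using finite by (simp add: finite_measure.emeasure_eq_measure)
    then have "AE t in \<sigma>. 1 / (complex_of_real t - \<i>) = 0"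
      by (intro AE_I[where N = "space \<sigma>"]) auto
    then have "F \<i> = 0"
      using F by (simp add: upper_half_plane_def integral_eq_zero_AE)
    moreover have "F \<i> \<in> upper_half_plane"
      using F_Nevanlinna(2) by (rule subsetD) (simp add: upper_half_plane_def)
    ultimately show False by (simp add: upper_half_plane_def)
  qed
  interpret op: orthogonal_polynomials \<sigma> P b c
    using sets nonnull spec[OF power] conjunct1[OF spec[OF P]] conjunct2[OF spec[OF P]]
      orth[rule_format] spec[OF rec] spec[OF c]
    by (rule orthogonal_polynomials.intro)
  have F_cauchy: "F z = op.cauchy 1 z" if "z \<in> upper_half_plane" for z
    using F that by (simp add: op.cauchy_def)
  \<comment> \<open>The given coefficients are the moments of \<open>\<sigma>\<close>, by uniqueness of expansions.\<close>
  have "expands F (moment_fps op.moment)"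
  proof (rule expands_cong[OF op.cauchy_expands[of 1, simplified, folded op.moment_def]])
    fix \<epsilon> :: real assume "0 < \<epsilon>"
    from eventually_sector_upper_half_plane[OF this]
    show "\<forall>\<^sub>F z in sector_at_infinity \<epsilon>. op.cauchy 1 z = F z"
      by eventually_elim (simp add: F_cauchy)
  qed
  then have "moment_fps s = moment_fps op.moment"
    using assms(3) expands_unique by (simp add: asymptotic_expansion_iff_expands)
  then have "s j = op.moment j" for j
    by (metis moment_fps_nth(2) neg_equal_iff_equal)
  then have s: "s = op.moment" by auto
  let ?s = "\<lambda>j. op.moment (j + 1)"
  let ?n = "normal_index ?s" and ?k = "normal_gap ?s"
  interpret bp: block_partition ?n ?k
    by (rule normal_index_partition[OF op.moment_normal_indices])
  obtain l u\<^sub>0 u\<^sub>1 where L: "L = bp.L_matrix l" and U: "U = bp.U_matrix u\<^sub>0 u\<^sub>1"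
    and LU: "J = inf_matrix_mult L U"
    using assms(5) unfolding block_LU_factorization_def Let_def s bp.L_matrix_def bp.U_matrix_def
    by blast
  interpret D: Darboux_transformation \<sigma> P b c ?n ?k F l u\<^sub>0 u\<^sub>1
    by standard (use F_Nevanlinna(1) F_cauchy LU in \<open>auto simp: J L U\<close>)
  have D: "(\<lambda>z. z * F z + of_real (s 0)) \<in> D_minus"
    using assms(1) op.moment_0_pos by (intro D_minus_shift) (auto simp: s)
  moreover have "generalized_Jacobi_matrix_of (\<lambda>z. z * F z + of_real (s 0)) (inf_matrix_mult U L)"
    unfolding U L s
    using D assms(2) rational_function_shift[of F "s 0"] asymptotic_expansion_shift[OF assms(3)]
    by (intro D.generalized_Jacobi_matrix_of_Darboux refl) (auto simp: s)
  ultimately show ?thesis ..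
qed

end
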